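(* Let $(N,v)$ be a knapsack budgeted game with representation $(\{(l_1,w_1),\ldots,(l_{|N|},w_{|N|})\}, l_{\mathrm{bin}})$, let $w_{\max}=\lceil l_{\mathrm{bin}}\cdot \max_k w_k/l_k\rceil$, and let $\epsilon>0$. Then for any given agent $i$, a number $\tilde\phi_i$ with $|\tilde\phi_i-\phi_i(v)|\le \epsilon\, w_{\max}$ can be computed in time $O\big((l_{\mathrm{bin}}^2/\epsilon+1)^{l_{\mathrm{bin}}+1}|N|^2\big)$.
   Context: A cooperative game $(N,v)$ consists of a finite set $N$ of agents and a function $v:2^N\to\mathbb R$ with $v(\emptyset)=0$. The Shapley value of agent $i$ is $\phi_i(v)=\sum_{S\subseteq N\setminus\{i\}}\frac{|S|!\,(|N|-|S|-1)!}{|N|!}\big(v(S\cup\{i\})-v(S)\big)$. A knapsack budgeted game is a cooperative game $(N,v)$, with agents labeled $1,\ldots,|N|$, given by nonnegative integers $(\{(l_1,w_1),\ldots,(l_{|N|},w_{|N|})\}, l_{\mathrm{bin}})$ with $0<l_i\le l_{\mathrm{bin}}$ for all $i$, such that $v(S)=\max_{S'\subseteq S:\ l(S')\le l_{\mathrm{bin}}} w(S')$ for all $S\subseteq N$, where $l(S')=\sum_{k\in S'}l_k$ and $w(S')=\sum_{k\in S'}w_k$. Running times count arithmetic operations at unit cost. *)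

theory Defs
  imports Complex_Main
begin

definition knap_val :: "(nat \<Rightarrow> nat) \<Rightarrow> (nat \<Rightarrow> nat) \<Rightarrow> nat \<Rightarrow> nat set \<Rightarrow> real" where
  "knap_val l w lbin S = Max {real (\<Sum>k\<in>S'. w k) | S'. S' \<subseteq> S \<and> (\<Sum>k\<in>S'. l k) \<le> lbin}"

definition shapley :: "nat set \<Rightarrow> (nat set \<Rightarrow> real) \<Rightarrow> nat \<Rightarrow> real" where
  "shapley N v i = (\<Sum>S\<in>Pow (N - {i}).
      (fact (card S) * fact (card N - card S - 1) / fact (card N)) * (v (S \<union> {i}) - v S))"

definition w_max :: "nat \<Rightarrow> (nat \<Rightarrow> nat) \<Rightarrow> (nat \<Rightarrow> nat) \<Rightarrow> nat \<Rightarrow> int" where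
  "w_max n l w lbin = \<lceil>real lbin * Max ((\<lambda>k. real (w k) / real (l k)) ` {1..n})\<rceil>"

type_synonym mem = "nat \<Rightarrow> real"

datatype aop = Add | Sub | Mul | Dvd

fun apply_op :: "aop \<Rightarrow> real \<Rightarrow> real \<Rightarrow> real" where
  "apply_op Add x y = x + y"
| "apply_op Sub x y = x - y"
| "apply_op Mul x y = x * y"
| "apply_op Dvd x y = x / y"

datatype com =
    SKIP
  | SetConst nat int
  | SetOp nat aop nat nat
  | SetFloor nat nat
  | LoadInd nat nat
  | StoreInd nat nat
  | Seq com com
  | IfPos nat com com
  | WhilePos nat com

inductive exec :: "com \<Rightarrow> mem \<Rightarrow> nat \<Rightarrow> mem \<Rightarrow> bool" where
  Skip: "exec SKIP m 0 m"
| SetConst: "exec (SetConst a c) m 1 (m(a := real_of_int c))"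
| SetOp: "exec (SetOp a f b c) m 1 (m(a := apply_op f (m b) (m c)))"
| SetFloor: "exec (SetFloor a b) m 1 (m(a := real_of_int \<lfloor>m b\<rfloor>))"
| LoadInd: "exec (LoadInd a b) m 1 (m(a := m (nat \<lfloor>m b\<rfloor>)))"
| StoreInd: "exec (StoreInd a b) m 1 (m(nat \<lfloor>m a\<rfloor> := m b))"
| Seq: "exec c1 m t1 m1 \<Longrightarrow> exec c2 m1 t2 m2 \<Longrightarrow> exec (Seq c1 c2) m (t1 + t2) m2"
| IfT: "m a > 0 \<Longrightarrow> exec c1 m t m' \<Longrightarrow> exec (IfPos a c1 c2) m (Suc t) m'"
| IfF: "\<not> m a > 0 \<Longrightarrow> exec c2 m t m' \<Longrightarrow> exec (IfPos a c1 c2) m (Suc t) m'"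
| WhileF: "\<not> m a > 0 \<Longrightarrow> exec (WhilePos a c) m 1 m"
| WhileT: "m a > 0 \<Longrightarrow> exec c m t1 m1 \<Longrightarrow> exec (WhilePos a c) m1 t2 m2 \<Longrightarrow>
           exec (WhilePos a c) m (Suc (t1 + t2)) m2"

text \<open>Input encoding: m[0] = n, m[1] = lbin, m[2] = i, m[3] = eps,
  m[2k+2] = l k and m[2k+3] = w k for k = 1..n, all other cells 0.
  The output is the content of cell 0 upon termination.\<close>

definition init_mem :: "nat \<Rightarrow> (nat \<Rightarrow> nat) \<Rightarrow> (nat \<Rightarrow> nat) \<Rightarrow> nat \<Rightarrow> nat \<Rightarrow> real \<Rightarrow> mem" where
  "init_mem n l w lbin i eps = (\<lambda>a.
      if a = 0 then real n
      else if a = 1 then real lbin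
      else if a = 2 then real i
      else if a = 3 then eps
      else if even a \<and> 1 \<le> (a - 2) div 2 \<and> (a - 2) div 2 \<le> n then real (l ((a - 2) div 2))
      else if odd a \<and> 1 \<le> (a - 3) div 2 \<and> (a - 3) div 2 \<le> n then real (w ((a - 3) div 2))
      else 0)"

end

theory Submission
  imports Defs
begin

text \<open>Let \<open>\<rho> = max w\<^sub>k / l\<^sub>k\<close> and round every weight down to a multiple of \<open>U = \<epsilon> \<rho>\<close>. A feasible set has at
  most \<open>l\<^sub>b\<^sub>i\<^sub>n\<close> members, so rounding lowers each coalition value by at most \<open>l\<^sub>b\<^sub>i\<^sub>n U \<le> \<epsilon> w\<^sub>m\<^sub>a\<^sub>x\<close>, and the
  same bound holds for marginal contributions and hence for their average, the Shapley value. After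
  rounding, the knapsack table \<open>c \<mapsto> T c\<close> (best weight within capacity \<open>c \<le> l\<^sub>b\<^sub>i\<^sub>n\<close>) of a coalition has
  entries below \<open>b = \<lfloor>l\<^sub>b\<^sub>i\<^sub>n / \<epsilon>\<rfloor> + 1\<close>, so a table together with the coalition size \<open>s\<close> is a number
  \<open>x = s B + (\<Sum>c. T c * b ^ c)\<close> with \<open>B = b ^ (l\<^sub>b\<^sub>i\<^sub>n + 1)\<close>.

  The Shapley value averages over a random coalition that is grown agent by agent: if \<open>s\<close> of the agents
  \<open>1, \<dots>, k - 1\<close> precede \<open>i\<close> in a random order, then agent \<open>k\<close> does so with probability
  \<open>(s + 1) / (k + 1)\<close>. Backward induction along this process computes the average: start with
  \<open>F x\<close> = marginal contribution of \<open>i\<close> in state \<open>x\<close>, and for \<open>k = n, \<dots>, 1\<close> replace \<open>F x\<close> by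
  \<open>(s + 1) / (k + 1) * F x' + (k - s) / (k + 1) * F x\<close>, where \<open>x'\<close> is the state after adding \<open>k\<close>; then
  \<open>U * F 0\<close> is the answer. Agent \<open>i\<close> itself is kept in the loop as a null agent with \<open>l\<^sub>i = w\<^sub>i = 0\<close>,
  which does not affect the average. For \<open>\<epsilon> \<ge> 1\<close> the answer \<open>0\<close> is good enough; this case must be
  separated because the time bound then leaves no room for a factor \<open>l\<^sub>b\<^sub>i\<^sub>n\<close>.\<close>

section \<open>Bounded execution\<close>

text \<open>A total-correctness judgement. \<open>T\<close> only bounds the time from above, so
  branches of different cost can share one bound.\<close>

definition runs :: "com \<Rightarrow> mem \<Rightarrow> nat \<Rightarrow> (mem \<Rightarrow> bool) \<Rightarrow> bool" where
  "runs c m T Q \<longleftrightarrow> (\<exists>t m'. exec c m t m' \<and> t \<le> T \<and> Q m')"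

definition eq_off :: "nat set \<Rightarrow> mem \<Rightarrow> mem \<Rightarrow> bool" where
  "eq_off A m m' \<longleftrightarrow> (\<forall>a. a \<notin> A \<longrightarrow> m' a = m a)"

fun blk :: "com list \<Rightarrow> com" where
  "blk [] = SKIP"
| "blk (c # cs) = Seq c (blk cs)"

fun basic :: "com \<Rightarrow> bool" where
  "basic (SetConst a c) = True"
| "basic (SetOp a f b c) = True"
| "basic (SetFloor a b) = True"
| "basic (LoadInd a b) = True"
| "basic (StoreInd a b) = True"
| "basic _ = False"

fun ev :: "com \<Rightarrow> mem \<Rightarrow> mem" where
  "ev (SetConst a c) m = m(a := real_of_int c)"
| "ev (SetOp a f b c) m = m(a := apply_op f (m b) (m c))"
| "ev (SetFloor a b) m = m(a := real_of_int \<lfloor>m b\<rfloor>)"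
| "ev (LoadInd a b) m = m(a := m (nat \<lfloor>m b\<rfloor>))"
| "ev (StoreInd a b) m = m(nat \<lfloor>m a\<rfloor> := m b)"
| "ev _ m = m"

lemma runs_mono:
  assumes "runs c m T Q" "T \<le> T'" "\<And>m'. Q m' \<Longrightarrow> Q' m'"
  shows "runs c m T' Q'"
  using assms unfolding runs_def by (meson order_trans)

lemma runs_seq:
  assumes "runs c1 m T1 (\<lambda>m1. runs c2 m1 T2 Q)" "T1 + T2 \<le> T"
  shows "runs (Seq c1 c2) m T Q"
proof -
  obtain t1 m1 where 1: "exec c1 m t1 m1" "t1 \<le> T1" "runs c2 m1 T2 Q"
    using assms(1) unfolding runs_def by blast
  then obtain t2 m2 where 2: "exec c2 m1 t2 m2" "t2 \<le> T2" "Q m2"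
    unfolding runs_def by blast
  have "exec (Seq c1 c2) m (t1 + t2) m2" using 1 2 exec.Seq by blast
  moreover have "t1 + t2 \<le> T" using 1 2 assms(2) by linarith
  ultimately show ?thesis using 2 unfolding runs_def by blast
qed

declare blk.simps [simp del]

lemma exec_basic: "basic c \<Longrightarrow> exec c m 1 (ev c m)"
  by (cases c) (auto simp del: One_nat_def intro: exec.intros)

lemma exec_blk: "list_all basic cs \<Longrightarrow> exec (blk cs) m (length cs) (fold ev cs m)"
proof (induction cs arbitrary: m)
  case Nil
  then show ?case by (simp add: exec.Skip blk.simps)
next
  case (Cons c cs)
  then have "exec (Seq c (blk cs)) m (1 + length cs) (fold ev cs (ev c m))"
    by (intro exec.Seq[OF exec_basic]) auto
  then show ?case by (simp add: blk.simps)
qed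

lemma runs_blk:
  assumes "list_all basic cs" "Q (fold ev cs m)" "length cs \<le> T"
  shows "runs (blk cs) m T Q"
  using assms exec_blk unfolding runs_def by blast

lemma runs_if:
  assumes "m a > 0 \<Longrightarrow> runs c1 m (T - 1) Q" "\<not> m a > 0 \<Longrightarrow> runs c2 m (T - 1) Q" "T > 0"
  shows "runs (IfPos a c1 c2) m T Q"
proof (cases "m a > 0")
  case True
  then obtain t m' where "exec c1 m t m'" "t \<le> T - 1" "Q m'" using assms(1) unfolding runs_def by blast
  moreover then have "Suc t \<le> T" using assms(3) by simp
  ultimately show ?thesis using exec.IfT[of m a, OF True] unfolding runs_def by blast
next
  case False
  then obtain t m' where "exec c2 m t m'" "t \<le> T - 1" "Q m'" using assms(2) unfolding runs_def by blast
  moreover then have "Suc t \<le> T" using assms(3) by simp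
  ultimately show ?thesis using exec.IfF[of m a, OF False] unfolding runs_def by blast
qed

lemma runs_blk_seq:
  assumes "list_all basic cs" "runs c (fold ev cs m) (T - length cs) Q" "length cs \<le> T"
  shows "runs (Seq (blk cs) c) m T Q"
  using assms by (intro runs_seq[of _ _ "length cs" _ "T - length cs"] runs_blk) auto

lemma runs_if_seq:
  assumes "m a > 0 \<Longrightarrow> runs (Seq c1 c) m (T - 1) Q" "\<not> m a > 0 \<Longrightarrow> runs (Seq c2 c) m (T - 1) Q" "T > 0"
  shows "runs (Seq (IfPos a c1 c2) c) m T Q"
proof -
  have "runs (IfPos a (Seq c1 c) (Seq c2 c)) m T Q" using assms by (rule runs_if)
  then obtain t m' where t: "exec (IfPos a (Seq c1 c) (Seq c2 c)) m t m'" "t \<le> T" "Q m'"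
    unfolding runs_def by blast
  have "exec (Seq (IfPos a c1 c2) c) m t m'"
    using t(1)
  proof cases
    case (IfT t')
    from IfT(3) show ?thesis
      by cases (use IfT exec.Seq[OF exec.IfT] in fastforce)
  next
    case (IfF t')
    from IfF(3) show ?thesis
      by cases (use IfF exec.Seq[OF exec.IfF] in fastforce)
  qed
  then show ?thesis using t unfolding runs_def by blast
qed

lemma runs_call_seq:
  assumes "runs c1 m T1 Q1" "\<And>m1. Q1 m1 \<Longrightarrow> runs c2 m1 (T - T1) Q" "T1 \<le> T"
  shows "runs (Seq c1 c2) m T Q"
  using assms by (intro runs_seq[of _ _ T1 _ "T - T1"]) (auto intro: runs_mono)

text \<open>The invariant is indexed by the number of rounds still to come. A round costs its body
  and one test; the final 1 is the failing test.\<close>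

lemma runs_while:
  assumes step: "\<And>j m. I (Suc j) m \<Longrightarrow> m a > 0 \<and> runs c m T (I j)"
    and stop: "\<And>m. I 0 m \<Longrightarrow> \<not> m a > 0"
    and init: "I j m"
    and bound: "j * Suc T + 1 \<le> T'"
  shows "runs (WhilePos a c) m T' (I 0)"
proof -
  have "runs (WhilePos a c) m (j * Suc T + 1) (I 0)"
    using init
  proof (induction j arbitrary: m)
    case 0
    then have "exec (WhilePos a c) m 1 m" by (intro exec.WhileF stop)
    then show ?case using 0 unfolding runs_def by auto
  next
    case (Suc j)
    from step[OF Suc.prems] obtain t1 m1 where
      1: "m a > 0" "exec c m t1 m1" "t1 \<le> T" "I j m1" unfolding runs_def by blast
    from Suc.IH[OF 1(4)] obtain t2 m2 where
      2: "exec (WhilePos a c) m1 t2 m2" "t2 \<le> j * Suc T + 1" "I 0 m2" unfolding runs_def by blast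
    have "exec (WhilePos a c) m (Suc (t1 + t2)) m2" using 1 2 exec.WhileT by blast
    moreover have "Suc (t1 + t2) \<le> Suc j * Suc T + 1" using 1 2 by simp
    ultimately show ?case using 2 unfolding runs_def by blast
  qed
  then show ?thesis using bound by (rule runs_mono)
qed

section \<open>The program\<close>

text \<open>Registers: 0 = \<open>n\<close>, 1 = \<open>l\<^sub>b\<^sub>i\<^sub>n\<close>, 2 = \<open>i\<close>, 3 = \<open>\<epsilon>\<close>, 4 = the constant 1, 5 = \<open>b\<close>, 6 = \<open>B\<close>, 7 = \<open>U\<close>,
  8 = current agent \<open>k\<close>, 9 = its address, 10 = \<open>l\<^sub>k\<close>, 11 = \<open>w\<^sub>k\<close> (later rounded), 12 = address of \<open>F\<close>,
  13 = state \<open>x\<close>, 14 = number of remaining states, 19 = \<open>b ^ l\<^sub>k\<close>, 30 = \<open>64 n\<close>; 15 to 18 hold the coefficients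
  of a pass, which replaces \<open>F x\<close> by \<open>(r15 + s r16) * F x' + (r17 - s r16) * F x + r18 * (marginal of k)\<close>.\<close>

text \<open>At capacity \<open>c\<close>, register 21 is \<open>x div b ^ c\<close>, 22 is \<open>x div b ^ (c - l\<^sub>k)\<close> and 23 is \<open>b ^ c\<close>; the increase
  \<open>T (c - l\<^sub>k) + w\<^sub>k - T c\<close> of the table entry, if positive, is added to the digit \<open>c\<close> of register 20 and kept in
  27, which after the last capacity \<open>l\<^sub>b\<^sub>i\<^sub>n\<close> therefore contains the marginal contribution.\<close>

definition digit_body :: com where
  "digit_body = Seq (blk [SetOp 25 Dvd 21 5, SetFloor 25 25, SetOp 28 Mul 25 5, SetOp 28 Sub 21 28,
      SetOp 21 Mul 25 4, SetOp 26 Dvd 22 5, SetFloor 26 26, SetOp 29 Mul 26 5, SetOp 29 Sub 22 29,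
      SetOp 22 Mul 26 4, SetOp 27 Add 29 11, SetOp 27 Sub 27 28])
    (Seq (IfPos 27 (blk [SetOp 28 Mul 27 23, SetOp 20 Add 20 28]) (blk [SetConst 27 0]))
      (blk [SetOp 23 Mul 23 5, SetOp 24 Sub 24 4]))"

text \<open>Register 4 holds 1, so \<open>SetOp a Mul b 4\<close> acts as an assignment, here and in
  the other programs.\<close>

definition pow_com :: com where
  "pow_com = Seq (blk [SetOp 19 Mul 4 4]) (WhilePos 24 (blk [SetOp 19 Mul 19 5, SetOp 24 Sub 24 4]))"

text \<open>\<open>F\<close> is updated in place: the new size exceeds the old one, so \<open>x' \<ge> x + B\<close> has not been overwritten yet
  when the states are treated in ascending order.\<close>

definition pass_body :: com where
  "pass_body = Seq (blk [SetOp 20 Mul 13 4, SetOp 21 Dvd 13 19, SetFloor 21 21, SetOp 22 Mul 13 4,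
      SetOp 23 Mul 19 4, SetOp 24 Sub 1 10, SetOp 24 Add 24 4])
    (Seq (WhilePos 24 digit_body)
      (Seq (blk [SetOp 20 Add 20 6, SetOp 20 Add 20 12, LoadInd 20 20, SetOp 25 Add 13 12, LoadInd 26 25,
          SetOp 28 Dvd 13 6, SetFloor 28 28, SetOp 28 Mul 28 16, SetOp 29 Add 15 28, SetOp 20 Mul 20 29,
          SetOp 29 Sub 17 28, SetOp 26 Mul 26 29, SetOp 20 Add 20 26, SetOp 27 Mul 27 18,
          SetOp 20 Add 20 27])
        (blk [StoreInd 25 20, SetOp 13 Add 13 4, SetOp 14 Sub 14 4])))"

text \<open>Coalition sizes range over \<open>0, ..., n\<close>, which gives
  \<open>(n + 1) * B\<close> states.\<close>

definition pass :: com where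
  "pass = Seq (blk [SetOp 24 Mul 10 4]) (Seq pow_com
    (Seq (blk [SetConst 13 0, SetOp 14 Add 0 4, SetOp 14 Mul 14 6]) (WhilePos 14 pass_body)))"

text \<open>The input has agent \<open>k\<close> at cells \<open>2 k + 2\<close> and
  \<open>2 k + 3\<close>. Cells 4 to 63 have been moved to \<open>64 n\<close> and onwards, so an
  address below 64 is shifted by \<open>64 n - 4\<close>.\<close>

definition load :: com where
  "load = Seq (blk [SetOp 9 Add 8 8, SetConst 28 2, SetOp 9 Add 9 28, SetConst 28 64, SetOp 26 Sub 28 9])
    (Seq (IfPos 26 (blk [SetOp 9 Add 9 30, SetConst 28 4, SetOp 9 Sub 9 28]) (blk []))
      (blk [LoadInd 10 9, SetOp 28 Add 9 4, LoadInd 11 28]))"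

definition ratio_body :: com where
  "ratio_body = Seq load (Seq (blk [SetOp 25 Dvd 11 10, SetOp 26 Sub 25 7])
    (Seq (IfPos 26 (blk [SetOp 7 Mul 25 4]) (blk [])) (blk [SetOp 8 Sub 8 4])))"

text \<open>The coefficients \<open>1/(k+1)\<close>, \<open>1/(k+1)\<close>, \<open>k/(k+1)\<close>,
  \<open>0\<close> specialise a pass to the backward induction step with probabilities
  \<open>(s+1)/(k+1)\<close> and \<open>(k-s)/(k+1)\<close>.\<close>

definition item_body :: com where
  "item_body = Seq load (Seq (blk [SetOp 11 Dvd 11 7, SetFloor 11 11, SetOp 25 Add 8 4,
      SetOp 15 Dvd 4 25, SetOp 16 Dvd 4 25, SetOp 17 Dvd 8 25, SetConst 18 0])
    (Seq pass (blk [SetOp 8 Sub 8 4])))"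

text \<open>With all coefficients 0 except the last, the pass forgets whatever \<open>F\<close> held
  and stores the marginal contributions of \<open>i\<close>. The entry of \<open>i\<close> in memory
  is cleared first, which makes \<open>i\<close> a null agent for the later loop; registers 10 and
  11 were loaded before that.\<close>

definition agent_com :: com where
  "agent_com = Seq (blk [SetOp 8 Mul 2 4]) (Seq load (Seq (blk [SetConst 25 0, StoreInd 9 25,
      StoreInd 28 25, SetOp 11 Dvd 11 7, SetFloor 11 11, SetConst 15 0, SetConst 16 0, SetConst 17 0,
      SetOp 18 Mul 4 4]) pass))"

definition ratio_com :: com where
  "ratio_com = Seq (blk [SetConst 7 0, SetOp 8 Mul 0 4]) (Seq (WhilePos 8 ratio_body)
     (blk [SetOp 7 Mul 7 3]))"

definition base_com :: com where
  "base_com = Seq (blk [SetOp 5 Dvd 1 3, SetFloor 5 5, SetOp 5 Add 5 4, SetOp 24 Add 1 4])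
     (Seq pow_com (blk [SetOp 6 Mul 19 4]))"

definition main_com :: com where
  "main_com = Seq base_com (Seq ratio_com (Seq agent_com
     (Seq (blk [SetOp 8 Mul 0 4]) (Seq (WhilePos 8 item_body)
       (blk [LoadInd 0 12, SetOp 0 Mul 0 7])))))"

text \<open>The input occupies the cells from 4 on and leaves no free register, so the first address \<open>64 n\<close> is
  computed inside cell 0 by doubling.\<close>

definition move :: "nat \<Rightarrow> com list" where
  "move j = [StoreInd 0 (4 + j), SetConst 4 1, SetOp 0 Add 0 4]"

definition relocate :: "com list" where
  "relocate = replicate 6 (SetOp 0 Add 0 0) @ concat (map move [0..<60])"

text \<open>Relocation leaves \<open>64 n + 60\<close> in cell 0. From it come the address
  \<open>128 n\<close> of \<open>F\<close>, the offset \<open>64 n\<close> and \<open>n\<close>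
  itself. Register 29 is \<open>1 - eps\<close> and separates the two cases.\<close>

definition shapley_com :: com where
  "shapley_com = Seq (blk relocate)
     (Seq (blk [SetConst 28 60, SetOp 0 Sub 0 28, SetOp 12 Add 0 0, SetOp 30 Mul 0 4, SetConst 28 64,
         SetOp 0 Dvd 0 28, SetOp 29 Sub 4 3])
       (IfPos 29 main_com (blk [SetConst 0 0])))"

section \<open>Correctness of the subroutines\<close>

definition dig :: "nat \<Rightarrow> nat \<Rightarrow> nat \<Rightarrow> nat" where
  "dig b x c = x div b ^ c mod b"

text \<open>Truncated subtraction is intended: this is the positive part of the increase of table
  entry \<open>l + c\<close>.\<close>

definition gain :: "nat \<Rightarrow> nat \<Rightarrow> nat \<Rightarrow> nat \<Rightarrow> nat \<Rightarrow> nat" where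
  "gain b l w x c = dig b x c + w - dig b x (l + c)"

lemma runs_pow:
  assumes "m 4 = 1" "m 5 = real b" "m 24 = real j"
  shows "runs pow_com m (3 * j + 2) (\<lambda>m'. eq_off {19, 24} m m' \<and> m' 19 = real (b ^ j))"
proof -
  define I where "I r m' \<longleftrightarrow> r \<le> j \<and> eq_off {19, 24} m m' \<and> m' 24 = real r \<and> m' 19 = real (b ^ (j - r))"
    for r and m' :: mem
  show ?thesis
    unfolding pow_com_def
  proof (rule runs_seq, rule runs_blk)
    let ?m = "fold ev [SetOp 19 Mul 4 4] m"
    show "runs (WhilePos 24 (blk [SetOp 19 Mul 19 5, SetOp 24 Sub 24 4])) ?m (3 * j + 1)
       (\<lambda>m'. eq_off {19, 24} m m' \<and> m' 19 = real (b ^ j))"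
    proof (rule runs_mono[OF runs_while[where I = I and j = j and T = 2]])
      fix r m' assume *: "I (Suc r) m'"
      then have e: "j - r = Suc (j - Suc r)" unfolding I_def by linarith
      have "m' 5 = real b" "m' 4 = 1" using * assms unfolding I_def eq_off_def by auto
      then have "runs (blk [SetOp 19 Mul 19 5, SetOp 24 Sub 24 4]) m' 2 (I r)"
        using * unfolding I_def e by (intro runs_blk) (auto simp: eq_off_def)
      then show "m' 24 > 0 \<and> runs (blk [SetOp 19 Mul 19 5, SetOp 24 Sub 24 4]) m' 2 (I r)"
        using * unfolding I_def by auto
    qed (use assms in \<open>auto simp: I_def eq_off_def\<close>)
  qed auto
qed

lemma floor_div_nat [simp]: "\<lfloor>real x / real y\<rfloor> = int (x div y)"
  using floor_divide_of_nat_eq[of x y] by simp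

lemma minus_mult_div_nat: "real x - real (x div b) * real b = real (x mod b)"
proof -
  have "real x = real (x div b * b + x mod b)" by simp
  then show ?thesis by (simp only: of_nat_add of_nat_mult)
qed

lemma runs_digit_body:
  assumes "m 4 = 1" "m 5 = real b" "m 11 = real w" "m 20 = real acc" "m 21 = real X"
    "m 22 = real Y" "m 23 = real p" "m 24 = real (Suc r)"
  shows "runs digit_body m 17 (\<lambda>m'. eq_off {20..29} m m' \<and> m' 20 = real (acc + (Y mod b + w - X mod b) * p)
     \<and> m' 21 = real (X div b) \<and> m' 22 = real (Y div b) \<and> m' 23 = real (p * b) \<and> m' 24 = real r
     \<and> m' 27 = real (Y mod b + w - X mod b))"
proof -
  \<comment> \<open>The two branches of the conditional realise the truncated subtraction on
    naturals.\<close>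
  have "real (Y mod b + w - X mod b) = real (Y mod b) + real w - real (X mod b)"
    if "real (X mod b) < real (Y mod b) + real w"
    using that by linarith
  moreover have "Y mod b + w - X mod b = 0" if "\<not> real (X mod b) < real (Y mod b) + real w"
    using that by linarith
  ultimately show ?thesis
    unfolding digit_body_def
    by (intro runs_blk_seq runs_if_seq runs_blk)
      (use assms in \<open>simp_all add: eq_off_def minus_mult_div_nat\<close>)
qed

lemma runs_digits:
  assumes "m 4 = 1" "m 5 = real b" "m 11 = real w" "m 20 = real x" "m 21 = real (x div b ^ l)"
    "m 22 = real x" "m 23 = real (b ^ l)" "m 24 = real (Suc r)"
  shows "runs (WhilePos 24 digit_body) m (18 * Suc r + 1) (\<lambda>m'. eq_off {20..29} m m'
     \<and> m' 20 = real (x + (\<Sum>c<Suc r. gain b l w x c * b ^ (l + c))) \<and> m' 27 = real (gain b l w x r))"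
proof -
  \<comment> \<open>Here \<open>c\<close> counts the capacities already treated. The quotients in 21
    and 22 stem from the old \<open>x\<close> and changes go only to 20, so every increase uses the
    old table and the agent is packed at most once. Register 27 is meaningless before the first
    round.\<close>
  define I where "I j m' \<longleftrightarrow> (\<exists>c. j + c = Suc r \<and> eq_off {20..29} m m'
      \<and> m' 20 = real (x + (\<Sum>c<c. gain b l w x c * b ^ (l + c)))
      \<and> m' 21 = real (x div b ^ (l + c)) \<and> m' 22 = real (x div b ^ c) \<and> m' 23 = real (b ^ (l + c))
      \<and> m' 24 = real j \<and> (c > 0 \<longrightarrow> m' 27 = real (gain b l w x (c - 1))))" for j and m' :: mem
  show ?thesis
  proof (rule runs_mono[OF runs_while[where I = I and j = "Suc r" and T = 17]])
    fix j m' assume "I (Suc j) m'"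
    then obtain c where c: "Suc j + c = Suc r" "eq_off {20..29} m m'"
      "m' 20 = real (x + (\<Sum>c<c. gain b l w x c * b ^ (l + c)))"
      "m' 21 = real (x div b ^ (l + c))" "m' 22 = real (x div b ^ c)" "m' 23 = real (b ^ (l + c))"
      "m' 24 = real (Suc j)" unfolding I_def by blast
    have r: "m' 4 = 1" "m' 5 = real b" "m' 11 = real w" using c(2) assms unfolding eq_off_def by auto
    have "runs digit_body m' 17 (I j)"
    proof (rule runs_mono[OF runs_digit_body[OF r c(3-7)]])
      fix m'' assume *: "eq_off {20..29} m' m'' \<and>
          m'' 20 = real (x + (\<Sum>c<c. gain b l w x c * b ^ (l + c)) +
            (x div b ^ c mod b + w - x div b ^ (l + c) mod b) * b ^ (l + c)) \<and>
          m'' 21 = real (x div b ^ (l + c) div b) \<and> m'' 22 = real (x div b ^ c div b) \<and>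
          m'' 23 = real (b ^ (l + c) * b) \<and> m'' 24 = real j \<and>
          m'' 27 = real (x div b ^ c mod b + w - x div b ^ (l + c) mod b)"
      have "b ^ (l + c) * b = b ^ (l + Suc c)" "x div b ^ (l + c) div b = x div b ^ (l + Suc c)"
        "x div b ^ c div b = x div b ^ Suc c"
        by (simp_all add: div_mult2_eq[symmetric] mult.commute)
      then show "I j m''" using * c(1,2) unfolding I_def
        by (intro exI[of _ "Suc c"]) (auto simp: eq_off_def gain_def dig_def add.assoc)
    qed auto
    then show "m' 24 > 0 \<and> runs digit_body m' 17 (I j)" using c by simp
  qed (use assms in \<open>auto simp: I_def eq_off_def\<close>)
qed

text \<open>The state with updated table but unchanged coalition size; the size is incremented
  separately by adding \<open>B\<close>.\<close>

definition stp :: "nat \<Rightarrow> nat \<Rightarrow> nat \<Rightarrow> nat \<Rightarrow> nat \<Rightarrow> nat" where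
  "stp b lbin l w x = x + (\<Sum>c\<le>lbin - l. gain b l w x c * b ^ (l + c))"

lemma nat_int_add3: "nat (int a + int b + int c) = a + b + c"
  by linarith

lemma runs_pass_body:
  assumes "m 1 = real lbin" "m 4 = 1" "m 5 = real b" "m 6 = real B" "m 10 = real l" "l \<le> lbin"
    "m 11 = real w" "m 12 = real base" "base \<ge> 64" "m 13 = real x" "m 14 = real (Suc r)" 
    "m 19 = real (b ^ l)"
  shows "runs pass_body m (18 * lbin + 44) (\<lambda>m'. eq_off ({13, 14} \<union> {20..29} \<union> {base + x}) m m'
     \<and> m' 13 = real (Suc x) \<and> m' 14 = real r
     \<and> m' (base + x) = (m 15 + real (x div B) * m 16) * m (base + (stp b lbin l w x + B))
         + (m 17 - real (x div B) * m 16) * m (base + x) + m 18 * real (gain b l w x (lbin - l)))"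
proof -
  have fl: "\<lfloor>real x / real b ^ l\<rfloor> = int (x div b ^ l)"
    using floor_div_nat[of x "b ^ l"] by simp
  let ?pre = "[SetOp 20 Mul 13 4, SetOp 21 Dvd 13 19, SetFloor 21 21, SetOp 22 Mul 13 4,
      SetOp 23 Mul 19 4, SetOp 24 Sub 1 10, SetOp 24 Add 24 4]"
  let ?m0 = "fold ev ?pre m"
  have off: "eq_off {20..29} m ?m0" by (simp add: eq_off_def)
  have dgs: "runs (WhilePos 24 digit_body) ?m0 (18 * Suc (lbin - l) + 1) (\<lambda>m'. eq_off {20..29} ?m0 m'
     \<and> m' 20 = real (x + (\<Sum>c<Suc (lbin - l). gain b l w x c * b ^ (l + c)))
     \<and> m' 27 = real (gain b l w x (lbin - l)))"
    by (rule runs_digits) (use assms fl in \<open>simp_all add: of_nat_diff\<close>)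
  show ?thesis
    unfolding pass_body_def
  proof (rule runs_blk_seq, simp, rule runs_call_seq[OF dgs])
    fix m1 assume *: "eq_off {20..29} ?m0 m1
     \<and> m1 20 = real (x + (\<Sum>c<Suc (lbin - l). gain b l w x c * b ^ (l + c)))
     \<and> m1 27 = real (gain b l w x (lbin - l))"
    have m1: "m1 a = m a" if "a \<notin> {20..29}" for a
      using * off that unfolding eq_off_def by auto
    have 27: "m1 27 = real (gain b l w x (lbin - l))" using * by blast
    have 20: "m1 20 = real (stp b lbin l w x)"
      using * unfolding stp_def by (simp only: lessThan_Suc_atMost)
    let ?cs = "[SetOp 20 Add 20 6, SetOp 20 Add 20 12, LoadInd 20 20, SetOp 25 Add 13 12, LoadInd 26 25,
        SetOp 28 Dvd 13 6, SetFloor 28 28, SetOp 28 Mul 28 16, SetOp 29 Add 15 28, SetOp 20 Mul 20 29,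
        SetOp 29 Sub 17 28, SetOp 26 Mul 26 29, SetOp 20 Add 20 26, SetOp 27 Mul 27 18,
        SetOp 20 Add 20 27]"
    define m2 where "m2 = fold ev ?cs m1"
    have "eq_off {20..29} m1 m2" unfolding m2_def by (simp add: eq_off_def)
    then have m2: "m2 a = m a" if "a \<notin> {20..29}" for a
      using m1[OF that] that unfolding eq_off_def by simp
    have m2_25: "m2 25 = real (base + x)"
      using assms unfolding m2_def by (simp add: m1)
    define v where "v = (m 15 + real (x div B) * m 16) * m (base + (stp b lbin l w x + B))
         + (m 17 - real (x div B) * m 16) * m (base + x) + m 18 * real (gain b l w x (lbin - l))"
    have m2_20: "m2 20 = v"
      using assms unfolding m2_def by (simp add: m1 20 27 v_def add.commute[of base] mult.commute nat_int_add nat_int_add3)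
    show "runs (Seq (blk ?cs) (blk [StoreInd 25 20, SetOp 13 Add 13 4, SetOp 14 Sub 14 4])) m1
       (18 * lbin + 44 - length ?pre - (18 * Suc (lbin - l) + 1)) (\<lambda>m'. eq_off ({13, 14} \<union> {20..29} \<union> {base + x}) m m'
     \<and> m' 13 = real (Suc x) \<and> m' 14 = real r
     \<and> m' (base + x) = v)"
    proof (rule runs_blk_seq, simp, unfold m2_def[symmetric], rule runs_blk)
      show "eq_off ({13, 14} \<union> {20..29} \<union> {base + x}) m (fold ev [StoreInd 25 20, SetOp 13 Add 13 4, SetOp 14 Sub 14 4] m2) \<and>
         fold ev [StoreInd 25 20, SetOp 13 Add 13 4, SetOp 14 Sub 14 4] m2 13 = real (Suc x) \<and>
         fold ev [StoreInd 25 20, SetOp 13 Add 13 4, SetOp 14 Sub 14 4] m2 14 = real r \<and>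
         fold ev [StoreInd 25 20, SetOp 13 Add 13 4, SetOp 14 Sub 14 4] m2 (base + x) = v"
        using assms by (auto simp: m2 m2_25 m2_20 eq_off_def)
    qed (use assms in auto)
  qed (use assms in auto)
qed

definition new_val :: "nat \<Rightarrow> nat \<Rightarrow> nat \<Rightarrow> nat \<Rightarrow> nat \<Rightarrow> (nat \<Rightarrow> real) \<Rightarrow> mem \<Rightarrow> nat \<Rightarrow> real" where
  "new_val b lbin l w B F m x = (m 15 + real (x div B) * m 16) * F (stp b lbin l w x + B)
     + (m 17 - real (x div B) * m 16) * F x + m 18 * real (gain b l w x (lbin - l))"

lemma stp_ge: "x \<le> stp b lbin l w x"
  unfolding stp_def by simp

text \<open>All numbers \<open>x\<close> in range are treated, even those that encode no actual
  table. Their successors may lie outside the array; this is harmless, as only codes of coalitions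
  are evaluated later.\<close>

lemma runs_pass:
  assumes "m 0 = real n" "m 1 = real lbin" "m 4 = 1" "m 5 = real b" "m 6 = real B" "B > 0"
    "m 10 = real l" "l \<le> lbin" "m 11 = real w" "m 12 = real base" "base \<ge> 64"
  shows "runs pass m ((n + 1) * B * (18 * lbin + 45) + 3 * lbin + 7)
    (\<lambda>m'. eq_off ({13, 14} \<union> {19..29} \<union> {base..<base + (n + 1) * B}) m m'
      \<and> (\<forall>x<(n + 1) * B. m' (base + x) = new_val b lbin l w B (\<lambda>y. m (base + y)) m x))"
proof -
  define N where "N = (n + 1) * B"
  define f where "f = new_val b lbin l w B (\<lambda>y. m (base + y)) m"
  let ?Q = "\<lambda>m'. eq_off ({13, 14} \<union> {19..29} \<union> {base..<base + N}) m m' \<and> (\<forall>x<N. m' (base + x) = f x)"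
  define I where "I j m' \<longleftrightarrow> (\<exists>z. j + z = N \<and> eq_off ({13, 14} \<union> {19..29} \<union> {base..<base + z}) m m'
      \<and> m' 13 = real z \<and> m' 14 = real j \<and> m' 19 = real (b ^ l) \<and> (\<forall>x<z. m' (base + x) = f x))" for j and m' :: mem
  have loop: "runs (WhilePos 14 pass_body) m1 (N * (18 * lbin + 45) + 1) ?Q" if "I N m1" for m1
  proof (rule runs_mono[OF runs_while[where I = I and j = N and T = "18 * lbin + 44"]])
    fix j m' assume "I (Suc j) m'"
    then obtain z where z: "Suc j + z = N" "eq_off ({13, 14} \<union> {19..29} \<union> {base..<base + z}) m m'"
      "m' 13 = real z" "m' 14 = real (Suc j)" "m' 19 = real (b ^ l)" "\<forall>x<z. m' (base + x) = f x"
      unfolding I_def by blast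
    have m': "m' a = m a" if "a \<notin> {13, 14} \<union> {19..29} \<union> {base..<base + z}" for a
      using z(2) that unfolding eq_off_def by blast
    have "runs pass_body m' (18 * lbin + 44) (I j)"
    proof (rule runs_mono[OF runs_pass_body[of m' lbin b B l w base z j]])
      fix m'' assume *: "eq_off ({13, 14} \<union> {20..29} \<union> {base + z}) m' m''
         \<and> m'' 13 = real (Suc z) \<and> m'' 14 = real j
         \<and> m'' (base + z) = (m' 15 + real (z div B) * m' 16) * m' (base + (stp b lbin l w z + B))
         + (m' 17 - real (z div B) * m' 16) * m' (base + z) + m' 18 * real (gain b l w z (lbin - l))"
      \<comment> \<open>By \<open>stp_ge\<close> and \<open>B > 0\<close> the successor lies beyond
        \<open>base + z\<close>, hence in a cell with its original content.\<close>
      have "m'' (base + z) = f z"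
        using * assms stp_ge[of z b lbin l w] by (simp add: m' f_def new_val_def)
      moreover have "m'' (base + x) = f x" if "x < z" for x
        using * that z(6) assms(11) unfolding eq_off_def by auto
      ultimately have "\<forall>x<Suc z. m'' (base + x) = f x" by (simp add: less_Suc_eq)
      moreover have "eq_off ({13, 14} \<union> {19..29} \<union> {base..<base + Suc z}) m m''"
        using * z(2) unfolding eq_off_def by auto
      moreover have "m'' 19 = real (b ^ l)" using * z(5) assms(11) unfolding eq_off_def by auto
      ultimately show "I j m''" using * z(1) unfolding I_def by (intro exI[of _ "Suc z"]) simp
    qed (use z assms in \<open>simp_all add: m'\<close>)
    then show "m' 14 > 0 \<and> runs pass_body m' (18 * lbin + 44) (I j)" using z by simp
  next
    show "I N m1" by fact
  qed (auto simp: I_def)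
  let ?m0 = "fold ev [SetOp 24 Mul 10 4] m"
  have "runs pass m (N * (18 * lbin + 45) + 3 * lbin + 7) ?Q"
    unfolding pass_def
  proof (rule runs_blk_seq, simp, rule runs_call_seq)
    show "runs pow_com ?m0 (3 * l + 2) (\<lambda>m'. eq_off {19, 24} ?m0 m' \<and> m' 19 = real (b ^ l))"
      by (rule runs_pow) (use assms in simp_all)
    fix m1 assume *: "eq_off {19, 24} ?m0 m1 \<and> m1 19 = real (b ^ l)"
    then have m1: "m1 a = m a" if "a \<noteq> 19" "a \<noteq> 24" for a
      using that unfolding eq_off_def by auto
    show "runs (Seq (blk [SetConst 13 0, SetOp 14 Add 0 4, SetOp 14 Mul 14 6]) (WhilePos 14 pass_body)) m1
       (N * (18 * lbin + 45) + 3 * lbin + 7 - length [SetOp 24 Mul 10 4] - (3 * l + 2)) ?Q"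
    proof (rule runs_blk_seq, simp)
      let ?m2 = "fold ev [SetConst 13 0, SetOp 14 Add 0 4, SetOp 14 Mul 14 6] m1"
      have "I N ?m2"
        unfolding I_def by (rule exI[of _ 0]) (use assms * in \<open>auto simp: m1 eq_off_def N_def algebra_simps\<close>)
      then show "runs (WhilePos 14 pass_body) ?m2 (N * (18 * lbin + 45) + 3 * lbin + 7 - length [SetOp 24 Mul 10 4] - (3 * l + 2) -
         length [SetConst 13 0, SetOp 14 Add 0 4, SetOp 14 Mul 14 6]) ?Q"
        by (rule runs_mono[OF loop]) (use assms in auto)
    qed (use assms in auto)
  qed (use assms in auto)
  then show ?thesis unfolding N_def f_def .
qed

section \<open>Knapsack tables\<close>

definition opt :: "(nat \<Rightarrow> nat) \<Rightarrow> (nat \<Rightarrow> nat) \<Rightarrow> nat set \<Rightarrow> nat \<Rightarrow> nat" where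
  "opt l w S c = Max (sum w ` {S'. S' \<subseteq> S \<and> sum l S' \<le> c})"

lemma opt_ge:
  assumes "finite S" "S' \<subseteq> S" "sum l S' \<le> c"
  shows "sum w S' \<le> opt l w S c"
  unfolding opt_def using assms by (intro Max_ge) auto

lemma opt_witness:
  assumes "finite S"
  obtains S' where "S' \<subseteq> S" "sum l S' \<le> c" "opt l w S c = sum w S'"
proof -
  have "opt l w S c \<in> sum w ` {S'. S' \<subseteq> S \<and> sum l S' \<le> c}"
    unfolding opt_def using assms by (intro Max_in) (auto intro!: exI[of _ "{}"])
  then show ?thesis using that by auto
qed

lemma opt_empty [simp]: "opt l w {} c = 0"
  by (rule opt_witness[of "{}" l c w]) auto

text \<open>The knapsack recursion: an optimal set either avoids \<open>k\<close>, or contains it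
  and leaves capacity \<open>c - l k\<close> to the others.\<close>

lemma opt_insert:
  assumes "finite S" "k \<notin> S"
  shows "opt l w (insert k S) c =
    (if l k \<le> c then max (opt l w S c) (opt l w S (c - l k) + w k) else opt l w S c)" (is "_ = ?r")
proof (rule antisym)
  have fin: "finite (insert k S)" using assms by simp
  obtain S' where S': "S' \<subseteq> insert k S" "sum l S' \<le> c" "opt l w (insert k S) c = sum w S'"
    using opt_witness[OF fin] .
  have f': "finite S'" using S'(1) fin finite_subset by blast
  show "opt l w (insert k S) c \<le> ?r"
  proof (cases "k \<in> S'")
    case True
    then have "sum l S' = l k + sum l (S' - {k})" "sum w S' = w k + sum w (S' - {k})"
      using f' by (simp_all add: sum.remove)
    moreover have "sum w (S' - {k}) \<le> opt l w S (c - l k)"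
      using S' calculation assms by (intro opt_ge) auto
    ultimately show ?thesis using S' by auto
  next
    case False
    then have "sum w S' \<le> opt l w S c" using S' assms by (intro opt_ge) auto
    then show ?thesis using S' by auto
  qed
  obtain S1 where S1: "S1 \<subseteq> S" "sum l S1 \<le> c" "opt l w S c = sum w S1"
    using opt_witness[OF assms(1)] .
  have le1: "opt l w S c \<le> opt l w (insert k S) c"
    using S1 fin by (auto intro: opt_ge)
  obtain S2 where S2: "S2 \<subseteq> S" "sum l S2 \<le> c - l k" "opt l w S (c - l k) = sum w S2"
    using opt_witness[OF assms(1)] .
  have "finite S2" "k \<notin> S2" using S2 assms finite_subset by auto
  then have "opt l w S (c - l k) + w k \<le> opt l w (insert k S) c" if "l k \<le> c"
    using S2 fin that opt_ge[of "insert k S" "insert k S2" l c w] by (simp add: subset_insertI2 add.commute)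
  then show "?r \<le> opt l w (insert k S) c" using le1 by auto
qed

lemma opt_cong:
  assumes "\<And>k. k \<in> S \<Longrightarrow> l k = l' k" "\<And>k. k \<in> S \<Longrightarrow> w k = w' k"
  shows "opt l w S c = opt l' w' S c"
proof -
  have "sum l S' = sum l' S'" "sum w S' = sum w' S'" if "S' \<subseteq> S" for S'
    using that assms by (auto intro!: sum.cong)
  then have "sum w ` {S'. S' \<subseteq> S \<and> sum l S' \<le> c} = sum w' ` {S'. S' \<subseteq> S \<and> sum l' S' \<le> c}"
    by (intro image_cong) auto
  then show ?thesis unfolding opt_def by simp
qed

text \<open>An item of length and weight 0 makes both alternatives of the recursion equal. This lets
  the loop run over all of \<open>1, ..., n\<close> without skipping \<open>i\<close>.\<close>

lemma opt_null:
  assumes "finite S"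
  shows "opt (l(i := 0)) (w(i := 0)) S c = opt l w (S - {i}) c"
proof -
  have "opt (l(i := 0)) (w(i := 0)) S c = opt (l(i := 0)) (w(i := 0)) (S - {i}) c"
  proof (cases "i \<in> S")
    case True
    then show ?thesis
      using assms opt_insert[of "S - {i}" i "l(i := 0)" "w(i := 0)" c] by (simp add: insert_absorb)
  qed simp
  also have "\<dots> = opt l w (S - {i}) c" by (rule opt_cong) auto
  finally show ?thesis .
qed

text \<open>With \<open>r = 1 / eps\<close> and rounded weights this bounds the table entries, and
  so justifies the base \<open>b\<close>.\<close>

lemma opt_le:
  assumes "finite S" "\<And>k. k \<in> S \<Longrightarrow> real (w k) \<le> r * real (l k)" "r \<ge> 0"
  shows "real (opt l w S c) \<le> r * real c"
proof -
  obtain S' where S': "S' \<subseteq> S" "sum l S' \<le> c" "opt l w S c = sum w S'"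
    using opt_witness[OF assms(1)] .
  have "real (sum w S') = (\<Sum>k\<in>S'. real (w k))" by simp
  also have "\<dots> \<le> (\<Sum>k\<in>S'. r * real (l k))" using S' assms by (intro sum_mono) auto
  also have "\<dots> = r * real (sum l S')" by (simp add: sum_distrib_left)
  also have "\<dots> \<le> r * real c" using S' assms by (intro mult_left_mono) (auto simp del: of_nat_sum)
  finally show ?thesis using S' by simp
qed

section \<open>Encoding a table and a coalition size in one number\<close>

definition code :: "nat \<Rightarrow> nat \<Rightarrow> nat \<Rightarrow> (nat \<Rightarrow> nat) \<Rightarrow> nat" where
  "code b L s T = s * b ^ (L + 1) + (\<Sum>c<L + 1. T c * b ^ c)"

lemma sum_digits_less:
  assumes "\<And>c. c < k \<Longrightarrow> T c < b"
  shows "(\<Sum>c<k. T c * b ^ c) < (b::nat) ^ k"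
  using assms
proof (induction k)
  case (Suc k)
  then have "(\<Sum>c<k. T c * b ^ c) < b ^ k" by simp
  then have "(\<Sum>c<Suc k. T c * b ^ c) < Suc (T k) * b ^ k" by simp
  also have "\<dots> \<le> b * b ^ k" using Suc.prems[of k] by (intro mult_right_mono) auto
  finally show ?case by simp
qed simp

lemma add_mult_div_nat: "lo < q \<Longrightarrow> (lo + h * q) div q = (h::nat)"
  by (subst div_mult_self1) auto

lemma code_div:
  assumes "\<And>c. c \<le> L \<Longrightarrow> T c < b"
  shows "code b L s T div b ^ (L + 1) = s"
proof -
  have "(\<Sum>c<L + 1. T c * b ^ c) < b ^ (L + 1)" using assms by (intro sum_digits_less) simp
  then have "((\<Sum>c<L + 1. T c * b ^ c) + s * b ^ (L + 1)) div b ^ (L + 1) = s" by (rule add_mult_div_nat)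
  then show ?thesis unfolding code_def by (metis add.commute)
qed

lemma code_less:
  assumes "\<And>c. c \<le> L \<Longrightarrow> T c < b" "s \<le> n"
  shows "code b L s T < (n + 1) * b ^ (L + 1)"
proof -
  have "(\<Sum>c<L + 1. T c * b ^ c) < b ^ (L + 1)" using assms by (intro sum_digits_less) simp
  then have "code b L s T < (s + 1) * b ^ (L + 1)" unfolding code_def by simp
  also have "\<dots> \<le> (n + 1) * b ^ (L + 1)" using assms by (intro mult_right_mono) auto
  finally show ?thesis .
qed

lemma dig_code:
  assumes T: "\<And>c. c \<le> L \<Longrightarrow> T c < b" and c: "c \<le> L"
  shows "dig b (code b L s T) c = T c"
proof -
  \<comment> \<open>All positions above \<open>c\<close>, including the size, divided by
    \<open>b ^ (c + 1)\<close>.\<close>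
  define hi where "hi = s * b ^ (L - c) + (\<Sum>j = Suc c..<L + 1. T j * b ^ (j - Suc c))"
  have "(\<Sum>j = Suc c..<L + 1. T j * b ^ j) = (\<Sum>j = Suc c..<L + 1. T j * b ^ (j - Suc c)) * b ^ Suc c"
    unfolding sum_distrib_right
    by (intro sum.cong) (auto simp: mult.assoc power_add[symmetric] simp del: power_Suc)
  moreover have "s * b ^ (L + 1) = s * b ^ (L - c) * b ^ Suc c"
    using c by (simp add: mult.assoc power_add[symmetric] del: power_Suc)
  moreover have "(\<Sum>j<L + 1. T j * b ^ j) = (\<Sum>j<Suc c. T j * b ^ j) + (\<Sum>j = Suc c..<L + 1. T j * b ^ j)"
    unfolding lessThan_atLeast0 using c by (intro sum.atLeastLessThan_concat[symmetric]) auto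
  ultimately have "code b L s T = (\<Sum>j<c. T j * b ^ j) + (T c + b * hi) * b ^ c"
    unfolding code_def hi_def by (simp add: algebra_simps)
  moreover have less: "(\<Sum>j<c. T j * b ^ j) < b ^ c" using T c by (intro sum_digits_less) simp
  ultimately have "code b L s T div b ^ c = T c + b * hi" by (simp only: add_mult_div_nat)
  then show ?thesis unfolding dig_def using T[OF c] by simp
qed

lemma gain_code:
  assumes "\<And>c. c \<le> L \<Longrightarrow> T c < b" "l + c \<le> L"
  shows "gain b l w (code b L s T) c = T c + w - T (l + c)"
  unfolding gain_def using assms by (simp add: dig_code)

text \<open>On naturals \<open>a + (d - a) = max a d\<close>, so adding the truncated increases
  performs the knapsack recursion at every capacity. Carries need no discussion, since
  \<open>code\<close> is linear in the entries.\<close>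

lemma stp_code:
  assumes T: "\<And>c. c \<le> L \<Longrightarrow> T c < b" and l: "l \<le> L"
  shows "stp b L l w (code b L s T) = code b L s (\<lambda>c. if l \<le> c then max (T c) (T (c - l) + w) else T c)"
proof -
  let ?T = "\<lambda>c. if l \<le> c then max (T c) (T (c - l) + w) else T c"
  have "(\<Sum>c\<le>L - l. gain b l w (code b L s T) c * b ^ (l + c)) = (\<Sum>c\<le>L - l. (T c + w - T (l + c)) * b ^ (l + c))"
    using l T by (intro sum.cong) (auto simp: gain_code)
  also have "\<dots> = (\<Sum>c\<in>{l..L}. (T (c - l) + w - T c) * b ^ c)"
    by (rule sum.reindex_bij_witness[of _ "\<lambda>c. c - l" "\<lambda>c. l + c"]) (use l in auto)
  also have "\<dots> = (\<Sum>c<L + 1. (if l \<le> c then T (c - l) + w - T c else 0) * b ^ c)"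
    by (rule sum.mono_neutral_cong_left) auto
  finally have "stp b L l w (code b L s T) = s * b ^ (L + 1) + ((\<Sum>c<L + 1. T c * b ^ c)
      + (\<Sum>c<L + 1. (if l \<le> c then T (c - l) + w - T c else 0) * b ^ c))"
    unfolding stp_def code_def by simp
  also have "(\<Sum>c<L + 1. T c * b ^ c) + (\<Sum>c<L + 1. (if l \<le> c then T (c - l) + w - T c else 0) * b ^ c)
      = (\<Sum>c<L + 1. ?T c * b ^ c)"
    unfolding sum.distrib[symmetric] add_mult_distrib[symmetric] by (intro sum.cong) auto
  finally show ?thesis unfolding code_def .
qed

section \<open>Shapley weights\<close>

text \<open>The probability that in a random order of \<open>k + 1\<close> agents exactly a given
  set of \<open>s\<close> agents precedes a distinguished one.\<close>

definition wgt :: "nat \<Rightarrow> nat \<Rightarrow> real" where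
  "wgt k s = fact s * fact (k - s) / fact (k + 1)"

lemma sum_Pow_insert:
  assumes "finite A" "a \<notin> A"
  shows "(\<Sum>S\<in>Pow (insert a A). f S) = (\<Sum>S\<in>Pow A. f S + f (insert a S) :: real)"
proof -
  have "(\<Sum>S\<in>Pow (insert a A). f S) = (\<Sum>S\<in>Pow A. f S) + (\<Sum>S\<in>insert a ` Pow A. f S)"
    unfolding Pow_insert using assms by (intro sum.union_disjoint) auto
  also have "(\<Sum>S\<in>insert a ` Pow A. f S) = (\<Sum>S\<in>Pow A. f (insert a S))"
    using assms by (subst sum.reindex) (auto simp: inj_on_def insert_eq_iff)
  finally show ?thesis by (simp add: sum.distrib)
qed

lemma wgt_Suc:
  assumes "s \<le> k"
  shows "wgt (Suc k) s = wgt k s * (real (k + 1 - s) / real (k + 2))"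
    and "wgt (Suc k) (Suc s) = wgt k s * (real (s + 1) / real (k + 2))"
  using assms by (simp_all add: wgt_def Suc_diff_le field_simps)

text \<open>One backward induction step: given \<open>S\<close>, agent \<open>k + 1\<close> joins
  with probability \<open>(card S + 1) / (k + 2)\<close>.\<close>

lemma sum_wgt_Suc:
  "(\<Sum>S\<in>Pow {1..Suc k}. wgt (Suc k) (card S) * f S)
   = (\<Sum>S\<in>Pow {1..k}. wgt k (card S) * (real (card S + 1) / real (k + 2) * f (insert (Suc k) S)
       + real (k + 1 - card S) / real (k + 2) * f S))"
proof -
  have "(\<Sum>S\<in>Pow {1..Suc k}. wgt (Suc k) (card S) * f S)
    = (\<Sum>S\<in>Pow {1..k}. wgt (Suc k) (card S) * f S + wgt (Suc k) (card (insert (Suc k) S)) * f (insert (Suc k) S))"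
    using sum_Pow_insert[of "{1..k}" "Suc k" "\<lambda>S. wgt (Suc k) (card S) * f S"]
    by (simp add: atLeastAtMostSuc_conv)
  also have "\<dots> = (\<Sum>S\<in>Pow {1..k}. wgt k (card S) * (real (card S + 1) / real (k + 2) * f (insert (Suc k) S)
       + real (k + 1 - card S) / real (k + 2) * f S))"
  proof (rule sum.cong)
    fix S assume "S \<in> Pow {1..k}"
    then have S: "finite S" "Suc k \<notin> S" "card S \<le> k"
      using finite_subset card_mono[of "{1..k}" S] by auto
    then have "card (insert (Suc k) S) = Suc (card S)" by simp
    then show "wgt (Suc k) (card S) * f S + wgt (Suc k) (card (insert (Suc k) S)) * f (insert (Suc k) S)
      = wgt k (card S) * (real (card S + 1) / real (k + 2) * f (insert (Suc k) S)
       + real (k + 1 - card S) / real (k + 2) * f S)"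
      using wgt_Suc[OF S(3)] by (simp add: distrib_left mult.assoc)
  qed simp
  finally show ?thesis .
qed

lemma sum_wgt: "(\<Sum>S\<in>Pow {1..k}. wgt k (card S)) = 1"
proof (induction k)
  case 0
  then show ?case by (simp add: wgt_def)
next
  case (Suc k)
  have "(\<Sum>S\<in>Pow {1..Suc k}. wgt (Suc k) (card S)) = (\<Sum>S\<in>Pow {1..k}. wgt k (card S) *
     (real (card S + 1) / real (k + 2) + real (k + 1 - card S) / real (k + 2)))"
    using sum_wgt_Suc[of k "\<lambda>_. 1"] by simp
  also have "\<dots> = (\<Sum>S\<in>Pow {1..k}. wgt k (card S))"
  proof (rule sum.cong)
    fix S assume "S \<in> Pow {1..k}"
    then have "card S \<le> k" using card_mono[of "{1..k}" S] by auto
    then have "real (card S + 1) / real (k + 2) + real (k + 1 - card S) / real (k + 2) = 1"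
      by (simp add: of_nat_diff add_divide_distrib[symmetric])
    then show "wgt k (card S) * (real (card S + 1) / real (k + 2) + real (k + 1 - card S) / real (k + 2))
      = wgt k (card S)" by simp
  qed simp
  finally show ?case using Suc by simp
qed

text \<open>The integrand ignores \<open>i\<close>, so the terms of \<open>S\<close> and
  \<open>insert i S\<close> merge, and their weights add up to the weight for one agent
  fewer.\<close>

lemma sum_wgt_null:
  assumes "i \<in> {1..n}"
  shows "(\<Sum>S\<in>Pow {1..n}. wgt n (card S) * f (S - {i})) = (\<Sum>S\<in>Pow ({1..n} - {i}). wgt (n - 1) (card S) * f S)"
proof -
  have ins: "{1..n} = insert i ({1..n} - {i})" using assms by auto
  have "(\<Sum>S\<in>Pow {1..n}. wgt n (card S) * f (S - {i}))
    = (\<Sum>S\<in>Pow ({1..n} - {i}). wgt n (card S) * f (S - {i}) + wgt n (card (insert i S)) * f (insert i S - {i}))"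
    by (subst ins, subst sum_Pow_insert) auto
  also have "\<dots> = (\<Sum>S\<in>Pow ({1..n} - {i}). wgt (n - 1) (card S) * f S)"
  proof (rule sum.cong)
    fix S assume S: "S \<in> Pow ({1..n} - {i})"
    then have fin: "finite S" "i \<notin> S" using finite_subset by auto
    have "card S \<le> card ({1..n} - {i})" using S by (intro card_mono) auto
    then have c: "card S \<le> n - 1" using assms by simp
    obtain k where k: "n = Suc k" using assms by (cases n) auto
    have "card (insert i S) = Suc (card S)" "S - {i} = S" "insert i S - {i} = S" using fin by auto
    moreover have "real (k + 1 - card S) / real (k + 2) + real (card S + 1) / real (k + 2) = 1"
      using c k by (simp add: of_nat_diff add_divide_distrib[symmetric])
    then have "wgt n (card S) + wgt n (Suc (card S)) = wgt (n - 1) (card S)"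
      using wgt_Suc[of "card S" k] c k by (simp only: distrib_left[symmetric] diff_Suc_1)
    ultimately show "wgt n (card S) * f (S - {i}) + wgt n (card (insert i S)) * f (insert i S - {i})
       = wgt (n - 1) (card S) * f S" by (simp add: distrib_right[symmetric])
  qed simp
  finally show ?thesis .
qed

lemma shapley_wgt:
  assumes "i \<in> {1..n}"
  shows "shapley {1..n} v i = (\<Sum>S\<in>Pow ({1..n} - {i}). wgt (n - 1) (card S) * (v (insert i S) - v S))"
  unfolding shapley_def wgt_def using assms
  by (intro sum.cong) (auto simp: diff_commute)

text \<open>The Shapley value is an average with nonnegative weights of sum 1, so a uniform error of
  the marginal contributions carries over unchanged.\<close>

lemma abs_shapley_diff_le:
  assumes i: "i \<in> {1..n}"
    and g: "\<And>S. S \<subseteq> {1..n} - {i} \<Longrightarrow> \<bar>g S - (v (insert i S) - v S)\<bar> \<le> d"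
  shows "\<bar>(\<Sum>S\<in>Pow {1..n}. wgt n (card S) * g (S - {i})) - shapley {1..n} v i\<bar> \<le> d"
proof -
  let ?P = "Pow ({1..n} - {i})"
  have "(\<Sum>S\<in>Pow {1..n}. wgt n (card S) * g (S - {i})) - shapley {1..n} v i
    = (\<Sum>S\<in>?P. wgt (n - 1) (card S) * (g S - (v (insert i S) - v S)))"
    unfolding sum_wgt_null[OF i] shapley_wgt[OF i] by (simp add: sum_subtractf[symmetric] algebra_simps)
  also have "\<bar>\<dots>\<bar> \<le> (\<Sum>S\<in>?P. \<bar>wgt (n - 1) (card S) * (g S - (v (insert i S) - v S))\<bar>)"
    by (rule sum_abs)
  also have "\<dots> \<le> (\<Sum>S\<in>?P. wgt (n - 1) (card S) * d)"
    using g by (intro sum_mono) (auto simp: abs_mult wgt_def intro!: mult_left_mono divide_right_mono)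
  also have "\<dots> = d"
    using sum_wgt_null[OF i, of "\<lambda>_. 1"] sum_wgt[of n] by (simp add: sum_distrib_right[symmetric])
  finally show ?thesis .
qed

section \<open>Rounding\<close>

lemma knap_val_eq:
  assumes "finite S"
  shows "knap_val l w c S = real (opt l w S c)"
proof -
  have "{real (sum w S') | S'. S' \<subseteq> S \<and> sum l S' \<le> c} = real ` sum w ` {S'. S' \<subseteq> S \<and> sum l S' \<le> c}"
    by (auto simp del: of_nat_sum)
  moreover have "Max (real ` sum w ` {S'. S' \<subseteq> S \<and> sum l S' \<le> c}) = real (opt l w S c)"
    unfolding opt_def using assms
    by (intro mono_Max_commute[symmetric]) (auto simp: mono_def intro!: exI[of _ "{}"])
  ultimately show ?thesis unfolding knap_val_def by simp
qed

text \<open>Rounding keeps feasibility. Positive integral lengths leave room for at most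
  \<open>c\<close> items in an optimal set, and each of them loses at most \<open>U\<close>.\<close>

lemma opt_rounding:
  assumes "finite S" "\<And>k. k \<in> S \<Longrightarrow> 0 < l k"
    and "\<And>k. k \<in> S \<Longrightarrow> U * real (w' k) \<le> real (w k)" "\<And>k. k \<in> S \<Longrightarrow> real (w k) \<le> U * real (w' k) + U"
    and "U \<ge> 0"
  shows "U * real (opt l w' S c) \<le> real (opt l w S c)"
    and "real (opt l w S c) \<le> U * real (opt l w' S c) + real c * U"
proof -
  obtain S' where S': "S' \<subseteq> S" "sum l S' \<le> c" "opt l w' S c = sum w' S'"
    using opt_witness[OF assms(1)] .
  have "U * real (sum w' S') \<le> real (sum w S')"
    using S' assms(3) by (auto simp: sum_distrib_left intro!: sum_mono)
  also have "\<dots> \<le> real (opt l w S c)" using S' assms(1) by (simp add: opt_ge del: of_nat_sum)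
  finally show "U * real (opt l w' S c) \<le> real (opt l w S c)" using S' by simp
  obtain R where R: "R \<subseteq> S" "sum l R \<le> c" "opt l w S c = sum w R"
    using opt_witness[OF assms(1)] .
  have "card R = (\<Sum>k\<in>R. 1)" by simp
  also have "\<dots> \<le> sum l R" using R assms(2) by (intro sum_mono) (auto simp: Suc_le_eq)
  finally have card: "card R \<le> c" using R by simp
  have "real (sum w R) \<le> (\<Sum>k\<in>R. U * real (w' k) + U)"
    using R assms(4) by (auto intro!: sum_mono)
  also have "\<dots> = U * real (sum w' R) + real (card R) * U" by (simp add: sum.distrib sum_distrib_left)
  also have "\<dots> \<le> U * real (opt l w' S c) + real c * U"
    using R card assms(1,5) by (intro add_mono mult_left_mono mult_right_mono) (auto simp: opt_ge simp del: of_nat_sum)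
  finally show "real (opt l w S c) \<le> U * real (opt l w' S c) + real c * U" using R by simp
qed

section \<open>Correctness of the program\<close>

text \<open>The cells below 64 serve as registers, so their former content lives at \<open>64 n + 0, \<dots>, 64 n + 59\<close>.\<close>

definition addr :: "nat \<Rightarrow> nat \<Rightarrow> nat" where
  "addr n k = (if k < 31 then 64 * n + (2 * k + 2) - 4 else 2 * k + 2)"

definition items :: "nat \<Rightarrow> (nat \<Rightarrow> nat) \<Rightarrow> (nat \<Rightarrow> nat) \<Rightarrow> mem \<Rightarrow> bool" where
  "items n l w m \<longleftrightarrow> (\<forall>k\<in>{1..n}. m (addr n k) = real (l k) \<and> m (Suc (addr n k)) = real (w k))"

text \<open>Separates the input from the registers below 64 and from \<open>F\<close>, which starts
  at \<open>128 n\<close>.\<close>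

lemma addr_bounds:
  assumes "k \<in> {1..n}"
  shows "64 \<le> addr n k" "Suc (addr n k) < 128 * n"
  using assms unfolding addr_def by auto

lemma addr_inject:
  assumes "k \<in> {1..n}" "k' \<in> {1..n}"
  shows "addr n k = addr n k' \<longleftrightarrow> k = k'"
  using assms unfolding addr_def by auto

lemma even_addr: "k \<ge> 1 \<Longrightarrow> even (addr n k)"
  unfolding addr_def by simp

lemma addr_neq_Suc:
  assumes "k \<in> {1..n}" "k' \<in> {1..n}"
  shows "addr n k \<noteq> Suc (addr n k')"
  using even_addr[of k n] even_addr[of k' n] assms by auto

lemma items_eq_off:
  assumes "items n l w m" "eq_off A m m'" "\<And>a. a \<in> A \<Longrightarrow> a < 64 \<or> 128 * n \<le> a"
  shows "items n l w m'"
  unfolding items_def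
proof
  fix k assume k: "k \<in> {1..n}"
  then have "addr n k \<notin> A" "Suc (addr n k) \<notin> A"
    using addr_bounds[OF k] assms(3)[of "addr n k"] assms(3)[of "Suc (addr n k)"] by linarith+
  then show "m' (addr n k) = real (l k) \<and> m' (Suc (addr n k)) = real (w k)"
    using assms(1,2) k unfolding items_def eq_off_def by simp
qed

lemma runs_load:
  assumes "m 4 = 1" "m 8 = real k" "m 30 = real (64 * n)" "k \<in> {1..n}" "items n l w m"
  shows "runs load m 12 (\<lambda>m'. eq_off {9, 10, 11, 26, 28} m m' \<and> m' 9 = real (addr n k)
    \<and> m' 28 = real (Suc (addr n k)) \<and> m' 10 = real (l k) \<and> m' 11 = real (w k))"
proof -
  have "m (addr n k) = real (l k)" "m (Suc (addr n k)) = real (w k)"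
    using assms unfolding items_def by auto
  moreover have "nat (int (addr n k) + 1) = Suc (addr n k)" by linarith
  moreover have "addr n k \<noteq> 8" "addr n k \<noteq> 9" "addr n k \<noteq> 10" "addr n k \<noteq> 25" "addr n k \<noteq> 26"
    "addr n k \<noteq> 27" "addr n k \<noteq> 28"
    using addr_bounds(1)[OF assms(4)] by linarith+
  moreover have "2 * real k + 2 + 64 * real n - 4 = real (addr n k)" if "real k < 31"
    using that assms(4) unfolding addr_def by auto
  moreover have "2 * real k + 2 = real (addr n k)" if "\<not> real k < 31"
    using that assms(4) unfolding addr_def by auto
  ultimately show ?thesis
    unfolding load_def
    by (intro runs_blk_seq runs_if_seq runs_blk) (use assms in \<open>simp_all add: eq_off_def\<close>)
qed

section \<open>Maximal weight per length, base of the encoding, and relocation of the input\<close>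

lemma runs_ratio:
  assumes "m 0 = real n" "m 3 = eps" "m 4 = 1" "m 30 = real (64 * n)" "items n l w m" "n \<ge> 1"
  shows "runs ratio_com m (18 * n + 4) (\<lambda>m'. eq_off {7, 8, 9, 10, 11, 25, 26, 28} m m'
     \<and> m' 7 = eps * Max ((\<lambda>k. real (w k) / real (l k)) ` {1..n}))"
proof -
  define f where "f k = real (w k) / real (l k)" for k
  \<comment> \<open>The inserted 0 gives the empty range a maximum; as ratios are nonnegative, it
    disappears at the end.\<close>
  define I where "I k m' \<longleftrightarrow> k \<le> n \<and> eq_off {7, 8, 9, 10, 11, 25, 26, 28} m m' \<and> m' 8 = real k
    \<and> m' 7 = Max (insert 0 (f ` {Suc k..n}))" for k and m' :: mem
  have body: "runs ratio_body m' 17 (I k)" if I: "I (Suc k) m'" for k m'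
  proof -
    have off: "eq_off {7, 8, 9, 10, 11, 25, 26, 28} m m'" and k: "Suc k \<le> n"
      using I unfolding I_def by auto
    have r: "m' 4 = 1" "m' 8 = real (Suc k)" "m' 30 = real (64 * n)" "Suc k \<in> {1..n}"
      using I assms unfolding I_def eq_off_def by auto
    have it: "items n l w m'" by (rule items_eq_off[OF assms(5) off]) auto
    show ?thesis
      unfolding ratio_body_def
    proof (rule runs_call_seq[OF runs_load[OF r it]])
      fix m1 assume *: "eq_off {9, 10, 11, 26, 28} m' m1 \<and> m1 9 = real (addr n (Suc k))
        \<and> m1 28 = real (Suc (addr n (Suc k))) \<and> m1 10 = real (l (Suc k)) \<and> m1 11 = real (w (Suc k))"
      then have m1: "m1 a = m a" if "a \<notin> {7, 8, 9, 10, 11, 25, 26, 28}" for a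
        using off that unfolding eq_off_def by auto
      have m1_8: "m1 8 = real (Suc k)" and m1_7: "m1 7 = Max (insert 0 (f ` {Suc (Suc k)..n}))"
        using * I unfolding I_def eq_off_def by auto
      have v: "m1 10 = real (l (Suc k))" "m1 11 = real (w (Suc k))" using * by auto
      have "{Suc k..n} = insert (Suc k) {Suc (Suc k)..n}" using k by auto
      then have "insert 0 (f ` {Suc k..n}) = insert (f (Suc k)) (insert 0 (f ` {Suc (Suc k)..n}))" by auto
      moreover have "Max (insert (f (Suc k)) (insert 0 (f ` {Suc (Suc k)..n})))
          = max (f (Suc k)) (Max (insert 0 (f ` {Suc (Suc k)..n})))"
        by (rule Max_insert) auto
      ultimately have "Max (insert 0 (f ` {Suc k..n})) = max (f (Suc k)) (Max (insert 0 (f ` {Suc (Suc k)..n})))"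
        by simp
      then have mx: "Max (insert 0 (f ` {Suc k..n})) = max (f (Suc k)) (m1 7)" using m1_7 by simp
      show "runs (Seq (blk [SetOp 25 Dvd 11 10, SetOp 26 Sub 25 7])
          (Seq (IfPos 26 (blk [SetOp 7 Mul 25 4]) (blk [])) (blk [SetOp 8 Sub 8 4]))) m1 (17 - 12) (I k)"
        unfolding I_def mx using k assms(3)
        by (intro runs_blk_seq runs_if_seq runs_blk) (simp_all add: m1 m1_8 v eq_off_def f_def max_def)
    qed simp
  qed
  let ?m0 = "fold ev [SetConst 7 0, SetOp 8 Mul 0 4] m"
  have loop: "runs (WhilePos 8 ratio_body) ?m0 (18 * n + 1) (I 0)"
  proof (rule runs_while[where j = n and T = 17])
    fix k m' assume *: "I (Suc k) m'"
    then show "m' 8 > 0 \<and> runs ratio_body m' 17 (I k)" using body[OF *] by (simp add: I_def)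
  qed (use assms in \<open>auto simp: I_def eq_off_def\<close>)
  show ?thesis
    unfolding ratio_com_def
  proof (rule runs_blk_seq, simp, rule runs_call_seq[OF loop])
    fix m1 assume *: "I 0 m1"
    have "Max (insert 0 (f ` {Suc 0..n})) = max 0 (Max (f ` {Suc 0..n}))"
      using assms(6) by (intro Max_insert) auto
    moreover have "0 \<le> f 1" "f 1 \<le> Max (f ` {Suc 0..n})"
      using assms(6) by (auto simp: f_def intro!: Max_ge)
    ultimately have "m1 7 = Max (f ` {1..n})" using * unfolding I_def by simp
    moreover have "m1 3 = eps" "eq_off {7, 8, 9, 10, 11, 25, 26, 28} m m1"
      using * assms unfolding I_def eq_off_def by auto
    ultimately show "runs (blk [SetOp 7 Mul 7 3]) m1 (18 * n + 4 - length [SetConst 7 0, SetOp 8 Mul 0 4] - (18 * n + 1))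
       (\<lambda>m'. eq_off {7, 8, 9, 10, 11, 25, 26, 28} m m' \<and> m' 7 = eps * Max ((\<lambda>k. real (w k) / real (l k)) ` {1..n}))"
      unfolding f_def by (intro runs_blk) (auto simp: eq_off_def)
  qed auto
qed

lemma runs_base:
  assumes "m 1 = real lbin" "m 3 = eps" "m 4 = 1" "eps > 0" and b: "b = nat \<lfloor>real lbin / eps\<rfloor> + 1"
  shows "runs base_com m (3 * lbin + 10) (\<lambda>m'. eq_off {5, 6, 19, 24} m m'
     \<and> m' 5 = real b \<and> m' 6 = real (b ^ (lbin + 1)))"
proof -
  let ?m0 = "fold ev [SetOp 5 Dvd 1 3, SetFloor 5 5, SetOp 5 Add 5 4, SetOp 24 Add 1 4] m"
  have "real_of_int \<lfloor>real lbin / eps\<rfloor> + 1 = real b" using assms by simp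
  then have m0: "?m0 5 = real b" "?m0 4 = 1" "?m0 24 = real (lbin + 1)" using assms by simp_all
  have off: "eq_off {5, 24} m ?m0" by (simp add: eq_off_def)
  show ?thesis
    unfolding base_com_def
  proof (rule runs_blk_seq, simp, rule runs_call_seq[OF runs_pow[OF m0(2,1,3)]])
    fix m1 assume *: "eq_off {19, 24} ?m0 m1 \<and> m1 19 = real (b ^ (lbin + 1))"
    then have "m1 5 = real b" "m1 4 = 1" "eq_off {5, 19, 24} m m1"
      using m0 off unfolding eq_off_def by auto
    then show "runs (blk [SetOp 6 Mul 19 4]) m1 (3 * lbin + 10 -
         length [SetOp 5 Dvd 1 3, SetFloor 5 5, SetOp 5 Add 5 4, SetOp 24 Add 1 4] - (3 * (lbin + 1) + 2))
       (\<lambda>m'. eq_off {5, 6, 19, 24} m m' \<and> m' 5 = real b \<and> m' 6 = real (b ^ (lbin + 1)))"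
      using * by (intro runs_blk) (auto simp: eq_off_def)
  qed auto
qed

text \<open>The target region starts at or above 64, so no source cell is overwritten too early.
  Cell 4 is saved by the very first move before the constant 1 replaces it.\<close>

lemma fold_moves:
  assumes "m 0 = real a0" "a0 \<ge> 64" "q \<le> 60"
  shows "let m' = fold ev (concat (map move [0..<q])) m in m' 0 = real (a0 + q) \<and> (q > 0 \<longrightarrow> m' 4 = 1)
     \<and> eq_off ({0, 4} \<union> {a0..<a0 + q}) m m' \<and> (\<forall>j<q. m' (a0 + j) = m (4 + j))"
  using assms(3)
proof (induction q)
  case 0
  then show ?case using assms by (simp add: eq_off_def)
next
  case (Suc q)
  define m1 where "m1 = fold ev (concat (map move [0..<q])) m"
  have m1: "m1 0 = real (a0 + q)" "eq_off ({0, 4} \<union> {a0..<a0 + q}) m m1" "\<forall>j<q. m1 (a0 + j) = m (4 + j)"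
    using Suc unfolding m1_def by (auto simp: Let_def)
  define m2 where "m2 = fold ev (concat (map move [0..<Suc q])) m"
  have "m1 (4 + q) = m (4 + q)"
  proof (cases "q = 0")
    case True
    then show ?thesis unfolding m1_def by simp
  next
    case False
    then show ?thesis using m1(2) Suc.prems assms(2) unfolding eq_off_def by simp
  qed
  moreover have "nat \<lfloor>m1 0\<rfloor> = a0 + q" using m1(1) by simp
  ultimately have m2: "m2 = m1(a0 + q := m (4 + q), 4 := 1, 0 := real (a0 + Suc q))"
    using m1(1) assms(2) unfolding m2_def by (simp add: m1_def[symmetric] move_def add.commute[of _ 1])
  have "m2 (a0 + j) = m (4 + j)" if "j < Suc q" for j
    using that m1(3) assms(2) unfolding m2 by (cases "j = q") auto
  moreover have "eq_off ({0, 4} \<union> {a0..<a0 + Suc q}) m m2"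
    using m1(2) unfolding m2 eq_off_def by auto
  moreover have "m2 0 = real (a0 + Suc q)" "m2 4 = 1" by (simp_all add: m2)
  ultimately show ?case unfolding m2_def[symmetric] Let_def by blast
qed

lemma list_all_relocate: "list_all basic relocate" "length relocate = 186"
  unfolding relocate_def list_all_iff move_def by (auto simp: length_concat comp_def sum_list_triv)

lemma runs_relocate:
  assumes m: "m = init_mem n l w lbin i eps" and "n \<ge> 1"
  shows "runs (blk relocate) m 186 (\<lambda>m'. m' 0 = real (64 * n + 60) \<and> m' 1 = real lbin \<and> m' 2 = real i
    \<and> m' 3 = eps \<and> m' 4 = 1 \<and> items n l w m')"
proof (rule runs_blk)
  define m0 where "m0 = fold ev (replicate 6 (SetOp 0 Add 0 0)) m"
  \<comment> \<open>Six doublings give the factor \<open>2 ^ 6 = 64\<close>.\<close>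
  have m0: "m0 = m(0 := real (64 * n))"
    unfolding m0_def m by (simp add: numeral_eq_Suc init_mem_def)
  define m1 where "m1 = fold ev relocate m"
  have "m1 = fold ev (concat (map move [0..<60])) m0" unfolding m1_def m0_def relocate_def by simp
  then have m1: "m1 0 = real (64 * n + 60)" "m1 4 = 1" "eq_off ({0, 4} \<union> {64 * n..<64 * n + 60}) m0 m1"
    "\<forall>j<60. m1 (64 * n + j) = m0 (4 + j)"
    using fold_moves[of m0 "64 * n" 60] assms(2) m0 by (simp_all add: Let_def)
  have "items n l w m1"
    unfolding items_def
  proof
    fix k assume k: "k \<in> {1..n}"
    then obtain j where j: "k = Suc j" by (cases k) auto
    have "m (2 * k + 2) = real (l k)" "m (Suc (2 * k + 2)) = real (w k)"
      using k unfolding m init_mem_def by auto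
    moreover have "m1 (addr n k) = m (2 * k + 2) \<and> m1 (Suc (addr n k)) = m (Suc (2 * k + 2))"
    proof (cases "k < 31")
      case True
      then have "addr n k = 64 * n + 2 * j" using j unfolding addr_def by simp
      moreover have "2 * k + 2 = 4 + 2 * j" "Suc (2 * k + 2) = 4 + Suc (2 * j)" using j by simp_all
      moreover have "m1 (64 * n + 2 * j) = m (4 + 2 * j)" "m1 (64 * n + Suc (2 * j)) = m (4 + Suc (2 * j))"
        using m1(4)[rule_format, of "2 * j"] m1(4)[rule_format, of "Suc (2 * j)"] True j
        by (simp_all add: m0)
      ultimately show ?thesis by (simp only: add_Suc_right)
    next
      case False
      then show ?thesis using k m1(3) unfolding eq_off_def m0 addr_def by simp
    qed
    ultimately show "m1 (addr n k) = real (l k) \<and> m1 (Suc (addr n k)) = real (w k)" by simp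
  qed
  moreover have "m1 1 = real lbin" "m1 2 = real i" "m1 3 = eps"
    using m1(3) assms unfolding eq_off_def m0 by (auto simp: init_mem_def)
  ultimately show "fold ev relocate m 0 = real (64 * n + 60) \<and> fold ev relocate m 1 = real lbin \<and>
    fold ev relocate m 2 = real i \<and> fold ev relocate m 3 = eps \<and> fold ev relocate m 4 = 1 \<and>
    items n l w (fold ev relocate m)" using m1 unfolding m1_def by blast
qed (simp_all add: list_all_relocate)

section \<open>The two uses of a pass\<close>

definition ctx :: "nat \<Rightarrow> nat \<Rightarrow> nat \<Rightarrow> real \<Rightarrow> mem \<Rightarrow> bool" where
  "ctx n lbin b U m \<longleftrightarrow> m 0 = real n \<and> m 1 = real lbin \<and> m 4 = 1 \<and> m 5 = real b \<and> m 6 = real (b ^ (lbin + 1))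
     \<and> m 7 = U \<and> m 12 = real (128 * n) \<and> m 30 = real (64 * n)"

text \<open>If \<open>U = 0\<close>, division by zero yields 0. This is the right value, because
  then all weights vanish.\<close>

definition rnd :: "real \<Rightarrow> (nat \<Rightarrow> nat) \<Rightarrow> nat \<Rightarrow> nat" where
  "rnd U w k = nat \<lfloor>real (w k) / U\<rfloor>"

lemma real_rnd: "U \<ge> 0 \<Longrightarrow> real_of_int \<lfloor>real (w k) / U\<rfloor> = real (rnd U w k)"
  unfolding rnd_def by simp

lemma ctx_eq_off:
  assumes "ctx n lbin b U m" "eq_off A m m'" "\<And>a. a \<in> A \<Longrightarrow> 8 \<le> a \<and> a \<noteq> 12 \<and> a \<noteq> 30"
  shows "ctx n lbin b U m'"
proof -
  have "m' a = m a" if "a \<in> {0, 1, 4, 5, 6, 7, 12, 30}" for a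
    using assms(2) assms(3)[of a] that unfolding eq_off_def by (cases "a \<in> A") auto
  then show ?thesis using assms(1) unfolding ctx_def by simp
qed

definition pass_time :: "nat \<Rightarrow> nat \<Rightarrow> nat \<Rightarrow> nat" where
  "pass_time n lbin b = (n + 1) * b ^ (lbin + 1) * (18 * lbin + 45) + 3 * lbin + 7"

lemma runs_pass_ctx:
  assumes "ctx n lbin b U m" "b > 0" "n \<ge> 1" "m 10 = real l" "l \<le> lbin" "m 11 = real w"
  shows "runs pass m (pass_time n lbin b)
    (\<lambda>m'. eq_off ({13, 14} \<union> {19..29} \<union> {128 * n..<128 * n + (n + 1) * b ^ (lbin + 1)}) m m'
      \<and> (\<forall>x<(n + 1) * b ^ (lbin + 1). m' (128 * n + x)
          = new_val b lbin l w (b ^ (lbin + 1)) (\<lambda>y. m (128 * n + y)) m x))"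
  unfolding pass_time_def
  by (rule runs_pass) (use assms in \<open>auto simp: ctx_def\<close>)

lemma runs_agent:
  assumes ctx: "ctx n lbin b U m" and it: "items n l w m" and m2: "m 2 = real i"
    and i: "i \<in> {1..n}" and b: "b > 0" and l: "l i \<le> lbin" and U: "U \<ge> 0"
  shows "runs agent_com m (22 + pass_time n lbin b) (\<lambda>m'. ctx n lbin b U m' \<and> items n (l(i := 0)) (w(i := 0)) m'
      \<and> (\<forall>x<(n + 1) * b ^ (lbin + 1). m' (128 * n + x) = real (gain b (l i) (rnd U w i) x (lbin - l i))))"
proof -
  let ?m0 = "fold ev [SetOp 8 Mul 2 4] m"
  have n: "n \<ge> 1" using i by simp
  have off0: "eq_off {8} m ?m0" by (simp add: eq_off_def)
  have r0: "?m0 4 = 1" "?m0 8 = real i" "?m0 30 = real (64 * n)" "items n l w ?m0"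
    using ctx m2 items_eq_off[OF it off0] unfolding ctx_def by simp_all
  let ?cs = "[SetConst 25 0, StoreInd 9 25, StoreInd 28 25, SetOp 11 Dvd 11 7, SetFloor 11 11,
      SetConst 15 0, SetConst 16 0, SetConst 17 0, SetOp 18 Mul 4 4]"
  show ?thesis
    unfolding agent_com_def
  proof (rule runs_blk_seq, simp, rule runs_call_seq[OF runs_load[OF r0(1-3) i r0(4)]])
    fix m1 assume *: "eq_off {9, 10, 11, 26, 28} ?m0 m1 \<and> m1 9 = real (addr n i)
      \<and> m1 28 = real (Suc (addr n i)) \<and> m1 10 = real (l i) \<and> m1 11 = real (w i)"
    then have off1: "eq_off {8, 9, 10, 11, 26, 28} m m1" using off0 unfolding eq_off_def by auto
    have ctx1: "ctx n lbin b U m1" by (rule ctx_eq_off[OF ctx off1]) auto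
    have it1: "items n l w m1" by (rule items_eq_off[OF it off1]) auto
    define m2 where "m2 = fold ev ?cs m1"
    have "nat (1 + int (addr n i)) = Suc (addr n i)" by linarith
    then have m2: "m2 = m1(25 := 0, addr n i := 0, Suc (addr n i) := 0, 11 := real (rnd U w i),
        15 := 0, 16 := 0, 17 := 0, 18 := 1)"
      using * ctx1 real_rnd[OF U, of w i] addr_bounds(1)[OF i] unfolding m2_def ctx_def by simp
    have off2: "eq_off ({11, 15, 16, 17, 18, 25} \<union> {addr n i, Suc (addr n i)}) m1 m2"
      unfolding m2 eq_off_def by simp
    have ctx2: "ctx n lbin b U m2"
      by (rule ctx_eq_off[OF ctx1 off2]) (use addr_bounds(1)[OF i] in auto)
    have it2: "items n (l(i := 0)) (w(i := 0)) m2"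
      unfolding items_def
    proof
      fix k assume k: "k \<in> {1..n}"
      have far: "addr n k \<ge> 64" "addr n i \<ge> 64" using addr_bounds(1) k i by blast+
      have eqs: "addr n k \<noteq> Suc (addr n i)" "Suc (addr n k) \<noteq> addr n i"
        using addr_neq_Suc k i by metis+
      show "m2 (addr n k) = real ((l(i := 0)) k) \<and> m2 (Suc (addr n k)) = real ((w(i := 0)) k)"
        using it1 k far eqs addr_inject[OF k i] unfolding m2 items_def by (cases "k = i") simp_all
    qed
    have r2: "m2 10 = real (l i)" "m2 11 = real (rnd U w i)" "m2 15 = 0" "m2 16 = 0" "m2 17 = 0" "m2 18 = 1"
      unfolding m2 using * addr_bounds(1)[OF i] by simp_all
    have "runs pass m2 (pass_time n lbin b) (\<lambda>m'. ctx n lbin b U m' \<and> items n (l(i := 0)) (w(i := 0)) m'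
      \<and> (\<forall>x<(n + 1) * b ^ (lbin + 1). m' (128 * n + x) = real (gain b (l i) (rnd U w i) x (lbin - l i))))"
    proof (rule runs_mono[OF runs_pass_ctx[OF ctx2 b n r2(1) l r2(2)] order_refl], elim conjE, intro conjI)
      fix m' assume off: "eq_off ({13, 14} \<union> {19..29} \<union> {128 * n..<128 * n + (n + 1) * b ^ (lbin + 1)}) m2 m'"
      show "ctx n lbin b U m'" by (rule ctx_eq_off[OF ctx2 off]) (use n in auto)
      show "items n (l(i := 0)) (w(i := 0)) m'" by (rule items_eq_off[OF it2 off]) auto
    qed (simp add: new_val_def r2)
    then show "runs (Seq (blk ?cs) pass) m1 (22 + pass_time n lbin b - length [SetOp 8 Mul 2 4] - 12)
      (\<lambda>m'. ctx n lbin b U m' \<and> items n (l(i := 0)) (w(i := 0)) m'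
      \<and> (\<forall>x<(n + 1) * b ^ (lbin + 1). m' (128 * n + x) = real (gain b (l i) (rnd U w i) x (lbin - l i))))"
      by (intro runs_blk_seq) (simp_all add: m2_def)
  qed auto
qed

lemma runs_item:
  assumes ctx: "ctx n lbin b U m" and it: "items n l w m" and m8: "m 8 = real (Suc k)"
    and k: "Suc k \<le> n" and b: "b > 0" and l: "l (Suc k) \<le> lbin" and U: "U \<ge> 0"
  shows "runs item_body m (20 + pass_time n lbin b) (\<lambda>m'. ctx n lbin b U m' \<and> items n l w m' \<and> m' 8 = real k
      \<and> (\<forall>x<(n + 1) * b ^ (lbin + 1). m' (128 * n + x) =
          (1 + real (x div b ^ (lbin + 1))) / real (k + 2)
            * m (128 * n + (stp b lbin (l (Suc k)) (rnd U w (Suc k)) x + b ^ (lbin + 1)))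
          + (real (k + 1) - real (x div b ^ (lbin + 1))) / real (k + 2) * m (128 * n + x)))"
    (is "runs _ _ _ ?Q")
proof -
  have n: "n \<ge> 1" and kn: "Suc k \<in> {1..n}" using k by auto
  have r0: "m 4 = 1" "m 30 = real (64 * n)" using ctx unfolding ctx_def by simp_all
  let ?cs = "[SetOp 11 Dvd 11 7, SetFloor 11 11, SetOp 25 Add 8 4,
      SetOp 15 Dvd 4 25, SetOp 16 Dvd 4 25, SetOp 17 Dvd 8 25, SetConst 18 0]"
  show ?thesis
    unfolding item_body_def
  proof (rule runs_call_seq[OF runs_load[OF r0(1) m8 r0(2) kn it]])
    fix m1 assume *: "eq_off {9, 10, 11, 26, 28} m m1 \<and> m1 9 = real (addr n (Suc k))
      \<and> m1 28 = real (Suc (addr n (Suc k))) \<and> m1 10 = real (l (Suc k)) \<and> m1 11 = real (w (Suc k))"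
    then have off1: "eq_off {9, 10, 11, 26, 28} m m1" by blast
    have ctx1: "ctx n lbin b U m1" by (rule ctx_eq_off[OF ctx off1]) auto
    have it1: "items n l w m1" by (rule items_eq_off[OF it off1]) auto
    have m1_8: "m1 8 = real (Suc k)" using off1 m8 unfolding eq_off_def by simp
    define m2 where "m2 = fold ev ?cs m1"
    have m2: "m2 = m1(11 := real (rnd U w (Suc k)), 25 := real (k + 2),
        15 := 1 / real (k + 2), 16 := 1 / real (k + 2), 17 := real (k + 1) / real (k + 2), 18 := 0)"
      using * ctx1 m1_8 real_rnd[OF U, of w "Suc k"] unfolding m2_def ctx_def by (simp add: add.commute)
    have off2: "eq_off {11, 15, 16, 17, 18, 25} m1 m2"
      unfolding m2 eq_off_def by simp
    have ctx2: "ctx n lbin b U m2" by (rule ctx_eq_off[OF ctx1 off2]) auto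
    have it2: "items n l w m2" by (rule items_eq_off[OF it1 off2]) auto
    have r2: "m2 10 = real (l (Suc k))" "m2 11 = real (rnd U w (Suc k))" "m2 15 = 1 / real (k + 2)"
      "m2 16 = 1 / real (k + 2)" "m2 17 = real (k + 1) / real (k + 2)" "m2 18 = 0"
      unfolding m2 using * by simp_all
    have F2: "m2 (128 * n + y) = m (128 * n + y)" for y
      using off1 off2 n unfolding eq_off_def by simp
    have pas: "runs (Seq pass (blk [SetOp 8 Sub 8 4])) m2 (pass_time n lbin b + 1) ?Q"
    proof (rule runs_call_seq[OF runs_pass_ctx[OF ctx2 b n r2(1) l r2(2)]])
      fix m3 assume p: "eq_off ({13, 14} \<union> {19..29} \<union> {128 * n..<128 * n + (n + 1) * b ^ (lbin + 1)}) m2 m3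
        \<and> (\<forall>x<(n + 1) * b ^ (lbin + 1). m3 (128 * n + x)
          = new_val b lbin (l (Suc k)) (rnd U w (Suc k)) (b ^ (lbin + 1)) (\<lambda>y. m2 (128 * n + y)) m2 x)"
      then have off3: "eq_off ({13, 14} \<union> {19..29} \<union> {128 * n..<128 * n + (n + 1) * b ^ (lbin + 1)}) m2 m3"
        by blast
      let ?m4 = "fold ev [SetOp 8 Sub 8 4] m3"
      have off4: "eq_off ({8, 13, 14} \<union> {19..29} \<union> {128 * n..<128 * n + (n + 1) * b ^ (lbin + 1)}) m2 ?m4"
        using off3 unfolding eq_off_def by simp
      have ctx4: "ctx n lbin b U ?m4" by (rule ctx_eq_off[OF ctx2 off4]) (use n in auto)
      moreover have "items n l w ?m4" by (rule items_eq_off[OF it2 off4]) auto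
      moreover have "m3 8 = real (Suc k)" "m3 4 = 1"
        using off3 m1_8 ctx4 n unfolding eq_off_def m2 ctx_def by auto
      then have "?m4 8 = real k" by simp
      moreover have "?m4 (128 * n + x) = (1 + real (x div b ^ (lbin + 1))) / real (k + 2)
            * m (128 * n + (stp b lbin (l (Suc k)) (rnd U w (Suc k)) x + b ^ (lbin + 1)))
          + (real (k + 1) - real (x div b ^ (lbin + 1))) / real (k + 2) * m (128 * n + x)"
        if x: "x < (n + 1) * b ^ (lbin + 1)" for x
      proof -
        have "?m4 (128 * n + x) = m3 (128 * n + x)" using n by simp
        also have "\<dots> = new_val b lbin (l (Suc k)) (rnd U w (Suc k)) (b ^ (lbin + 1)) (\<lambda>y. m2 (128 * n + y)) m2 x"
          using p x by blast
        finally show ?thesis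
          unfolding new_val_def r2 F2 by (simp only: add_divide_distrib diff_divide_distrib times_divide_eq_right mult_1_right mult_zero_left add_0_right)
      qed
      ultimately show "runs (blk [SetOp 8 Sub 8 4]) m3 (pass_time n lbin b + 1 - pass_time n lbin b) ?Q"
        by (intro runs_blk) auto
    qed simp
    show "runs (Seq (blk ?cs) (Seq pass (blk [SetOp 8 Sub 8 4]))) m1 (20 + pass_time n lbin b - 12) ?Q"
      by (rule runs_blk_seq, simp, rule runs_mono[OF pas[unfolded m2_def]]) auto
  qed auto
qed

text \<open>The third bound is independent of the weights: with \<open>r\<close> the maximal ratio,
  \<open>w k / U\<close> is at most \<open>r * l k / (eps * r)\<close>.\<close>

lemma rnd_bounds:
  assumes "k \<in> {1..n}" "0 < l k" "eps > 0"
    and U: "U = eps * Max ((\<lambda>k. real (w k) / real (l k)) ` {1..n})"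
  shows "U * real (rnd U w k) \<le> real (w k)" "real (w k) \<le> U * real (rnd U w k) + U"
    "real (rnd U w k) \<le> 1 / eps * real (l k)" "U \<ge> 0"
proof -
  define r where "r = Max ((\<lambda>k. real (w k) / real (l k)) ` {1..n})"
  have "real (w k) / real (l k) \<le> r" unfolding r_def using assms(1) by (intro Max_ge) auto
  then have wr: "real (w k) \<le> r * real (l k)" using assms(2) by (simp add: field_simps)
  have "0 \<le> real (w k) / real (l k)" by simp
  then have r0: "r \<ge> 0" using \<open>real (w k) / real (l k) \<le> r\<close> by linarith
  have Ur: "U = eps * r" unfolding U r_def ..
  then show U0: "U \<ge> 0" using r0 assms(3) by simp
  have fl: "real (rnd U w k) = real_of_int \<lfloor>real (w k) / U\<rfloor>" using real_rnd[OF U0] by simp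
  show "U * real (rnd U w k) \<le> real (w k)"
  proof (cases "U = 0")
    case False
    then have "U > 0" using U0 by simp
    moreover have "real (rnd U w k) \<le> real (w k) / U" unfolding fl by linarith
    ultimately show ?thesis by (simp add: field_simps)
  qed simp
  show "real (w k) \<le> U * real (rnd U w k) + U"
  proof (cases "U = 0")
    case True
    then have "r = 0" using Ur assms(3) by simp
    then show ?thesis using wr True by simp
  next
    case False
    then have "U > 0" using U0 by simp
    moreover have "real (w k) / U \<le> real (rnd U w k) + 1" unfolding fl by linarith
    ultimately show ?thesis by (simp add: field_simps)
  qed
  have "real (rnd U w k) \<le> real (w k) / U" unfolding fl by linarith
  also have "\<dots> \<le> 1 / eps * real (l k)"
  proof (cases "r = 0")
    case True
    then show ?thesis using Ur assms(3) by simp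
  next
    case False
    then have "r > 0" using r0 by simp
    then show ?thesis using wr assms(3) unfolding Ur by (simp add: field_simps)
  qed
  finally show "real (rnd U w k) \<le> 1 / eps * real (l k)" .
qed

definition main_time :: "nat \<Rightarrow> nat \<Rightarrow> nat \<Rightarrow> nat" where
  "main_time n lbin b = 3 * lbin + 18 * n + 41 + pass_time n lbin b + n * (21 + pass_time n lbin b)"

section \<open>The complete dynamic program\<close>

lemma runs_main:
  assumes m: "m 0 = real n" "m 1 = real lbin" "m 2 = real i" "m 3 = eps" "m 4 = 1" "m 12 = real (128 * n)"
      "m 30 = real (64 * n)" "items n l w m"
    and i: "i \<in> {1..n}" and l: "\<And>k. k \<in> {1..n} \<Longrightarrow> 0 < l k \<and> l k \<le> lbin" and eps: "eps > 0"
    and b: "b = nat \<lfloor>real lbin / eps\<rfloor> + 1"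
    and U: "U = eps * Max ((\<lambda>k. real (w k) / real (l k)) ` {1..n})"
  shows "runs main_com m (main_time n lbin b) (\<lambda>m'. m' 0 = (\<Sum>S\<in>Pow {1..n}. wgt n (card S) *
     (real (opt l (rnd U w) (insert i (S - {i})) lbin) - real (opt l (rnd U w) (S - {i}) lbin))) * U)"
proof -
  define w' where "w' = rnd U w"
  define tgt where "tgt = (\<Sum>S\<in>Pow {1..n}. wgt n (card S) *
     (real (opt l w' (insert i (S - {i})) lbin) - real (opt l w' (S - {i}) lbin)))"
  define l0 where "l0 = l(i := 0)"
  define w0 where "w0 = w(i := 0)"
  define T where "T S = opt l0 (w'(i := 0)) S" for S
  let ?B = "b ^ (lbin + 1)"
  let ?pt = "pass_time n lbin b"
  have n: "n \<ge> 1" and b0: "b > 0" using i b by auto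
  have U0: "U \<ge> 0" using rnd_bounds(4)[of i n l eps U w] i l eps U by simp
  have rnd0: "rnd U w0 = w'(i := 0)" unfolding rnd_def w0_def w'_def by auto
  have T_eq: "T S c = opt l w' (S - {i}) c" if "S \<subseteq> {1..n}" for S c
    unfolding T_def l0_def using that finite_subset by (intro opt_null) auto
  have T_less: "T S c < b" if "S \<subseteq> {1..n}" "c \<le> lbin" for S c
  proof -
    have "real (opt l w' (S - {i}) c) \<le> 1 / eps * real c"
      unfolding w'_def using that finite_subset eps l U
      by (intro opt_le rnd_bounds(3)[of _ n]) auto
    also have "\<dots> \<le> real lbin / eps" using that eps by (simp add: divide_right_mono)
    also have "\<dots> < real b" unfolding b using eps by simp linarith
    finally show ?thesis using T_eq[OF that(1)] by simp
  qed
  have card_le: "card S \<le> k" if "S \<subseteq> {1..k}" for S k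
    using card_mono[OF _ that] by simp
  define cd where "cd S = code b lbin (card S) (T S)" for S
  have cd_div: "cd S div ?B = card S" if "S \<subseteq> {1..n}" for S
    unfolding cd_def using T_less[OF that] by (rule code_div)
  have cd_less: "cd S < (n + 1) * ?B" if "S \<subseteq> {1..n}" for S
    unfolding cd_def using T_less[OF that] card_le[OF that] by (rule code_less)
  \<comment> \<open>The arithmetic transition on codes mirrors the insertion of an agent into the
    coalition.\<close>
  have cd_stp: "stp b lbin (l0 (Suc k)) (rnd U w0 (Suc k)) (cd S) + ?B = cd (insert (Suc k) S)"
    if S: "S \<subseteq> {1..k}" and k: "Suc k \<le> n" for S k
  proof -
    have fin: "finite S" and nin: "Suc k \<notin> S" using S finite_subset by auto
    have Sn: "S \<subseteq> {1..n}" using S k by auto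
    have "l0 (Suc k) \<le> lbin" unfolding l0_def using l[of "Suc k"] k by simp
    then have "stp b lbin (l0 (Suc k)) (rnd U w0 (Suc k)) (cd S) = code b lbin (card S)
      (\<lambda>c. if l0 (Suc k) \<le> c then max (T S c) (T S (c - l0 (Suc k)) + rnd U w0 (Suc k)) else T S c)"
      unfolding cd_def using T_less[OF Sn] by (intro stp_code)
    also have "(\<lambda>c. if l0 (Suc k) \<le> c then max (T S c) (T S (c - l0 (Suc k)) + rnd U w0 (Suc k)) else T S c)
      = T (insert (Suc k) S)"
      unfolding T_def rnd0 using opt_insert[OF fin nin, of l0 "w'(i := 0)"] by fastforce
    finally show ?thesis unfolding cd_def using fin nin by (simp add: code_def)
  qed
  \<comment> \<open>The weighted average of \<open>F\<close> over the coalitions among the first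
    \<open>k\<close> agents never changes; for \<open>k = 0\<close> it is the single value
    \<open>F 0\<close>.\<close>
  define J where "J k m' \<longleftrightarrow> k \<le> n \<and> ctx n lbin b U m' \<and> items n l0 w0 m' \<and> m' 8 = real k
    \<and> (\<Sum>S\<in>Pow {1..k}. wgt k (card S) * m' (128 * n + cd S)) = tgt" for k and m' :: mem
  have step: "runs item_body m' (20 + ?pt) (J k)" if J: "J (Suc k) m'" for k m'
  proof -
    have k: "Suc k \<le> n" and c: "ctx n lbin b U m'" "items n l0 w0 m'" "m' 8 = real (Suc k)"
      and sm: "(\<Sum>S\<in>Pow {1..Suc k}. wgt (Suc k) (card S) * m' (128 * n + cd S)) = tgt"
      using J unfolding J_def by auto
    have lk: "l0 (Suc k) \<le> lbin" unfolding l0_def using l[of "Suc k"] k by simp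
    show ?thesis
    proof (rule runs_mono[OF runs_item[OF c k b0 lk U0] order_refl])
      fix m'' assume *: "ctx n lbin b U m'' \<and> items n l0 w0 m'' \<and> m'' 8 = real k
        \<and> (\<forall>x<(n + 1) * ?B. m'' (128 * n + x) = (1 + real (x div ?B)) / real (k + 2)
            * m' (128 * n + (stp b lbin (l0 (Suc k)) (rnd U w0 (Suc k)) x + ?B))
          + (real (k + 1) - real (x div ?B)) / real (k + 2) * m' (128 * n + x))"
      have "(\<Sum>S\<in>Pow {1..k}. wgt k (card S) * m'' (128 * n + cd S))
        = (\<Sum>S\<in>Pow {1..k}. wgt k (card S) * (real (card S + 1) / real (k + 2) * m' (128 * n + cd (insert (Suc k) S))
            + real (k + 1 - card S) / real (k + 2) * m' (128 * n + cd S)))"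
      proof (rule sum.cong)
        fix S assume "S \<in> Pow {1..k}"
        then have S: "S \<subseteq> {1..k}" "S \<subseteq> {1..n}" using k by auto
        have "real (k + 1 - card S) = real (k + 1) - real (card S)" using card_le[OF S(1)] by simp
        then show "wgt k (card S) * m'' (128 * n + cd S) = wgt k (card S) *
            (real (card S + 1) / real (k + 2) * m' (128 * n + cd (insert (Suc k) S))
            + real (k + 1 - card S) / real (k + 2) * m' (128 * n + cd S))"
          using *[THEN conjunct2, THEN conjunct2, THEN conjunct2, rule_format, OF cd_less[OF S(2)]]
          unfolding cd_div[OF S(2)] cd_stp[OF S(1) k] by simp
      qed simp
      also have "\<dots> = tgt" using sum_wgt_Suc[of k "\<lambda>S. m' (128 * n + cd S)"] sm by simp
      finally show "J k m''" unfolding J_def using * k by simp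
    qed
  qed
  have init: "J n (fold ev [SetOp 8 Mul 0 4] m')"
    if c: "ctx n lbin b U m'" "items n l0 w0 m'"
      and F: "\<forall>x<(n + 1) * ?B. m' (128 * n + x) = real (gain b (l i) (w' i) x (lbin - l i))" for m'
  proof -
    let ?m = "fold ev [SetOp 8 Mul 0 4] m'"
    have off: "eq_off {8} m' ?m" by (simp add: eq_off_def)
    have "ctx n lbin b U ?m" by (rule ctx_eq_off[OF c(1) off]) auto
    moreover have "items n l0 w0 ?m" by (rule items_eq_off[OF c(2) off]) auto
    moreover have "?m 8 = real n" using c(1) unfolding ctx_def by simp
    moreover have "(\<Sum>S\<in>Pow {1..n}. wgt n (card S) * ?m (128 * n + cd S)) = tgt"
      unfolding tgt_def
    proof (rule sum.cong)
      fix S assume "S \<in> Pow {1..n}"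
      then have S: "S \<subseteq> {1..n}" by simp
      have fin: "finite (S - {i})" using S finite_subset by blast
      have li: "l i \<le> lbin" using l i by blast
      have "?m (128 * n + cd S) = m' (128 * n + cd S)" using n by simp
      also have "\<dots> = real (gain b (l i) (w' i) (cd S) (lbin - l i))" using F cd_less[OF S] by blast
      \<comment> \<open>The increase at full capacity \<open>lbin\<close> is the marginal
        contribution of \<open>i\<close>.\<close>
      also have "gain b (l i) (w' i) (cd S) (lbin - l i) = T S (lbin - l i) + w' i - T S lbin"
        unfolding cd_def using gain_code[of lbin "T S" b "l i" "lbin - l i"] T_less[OF S] li by simp
      also have "real \<dots> = real (opt l w' (insert i (S - {i})) lbin) - real (opt l w' (S - {i}) lbin)"
        unfolding T_eq[OF S] using opt_insert[OF fin, of i l w' lbin] li by auto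
      finally show "wgt n (card S) * ?m (128 * n + cd S) = wgt n (card S) *
        (real (opt l w' (insert i (S - {i})) lbin) - real (opt l w' (S - {i}) lbin))" by simp
    qed simp
    ultimately show ?thesis unfolding J_def by blast
  qed
  have fin: "runs (blk [LoadInd 0 12, SetOp 0 Mul 0 7]) m' 2 (\<lambda>m'. m' 0 = tgt * U)" if J: "J 0 m'" for m'
  proof -
    have "cd {} = 0" unfolding cd_def code_def T_def by simp
    then have "m' (128 * n) = tgt" using J unfolding J_def by (simp add: wgt_def)
    moreover have "nat \<lfloor>128 * real n\<rfloor> = 128 * n" by linarith
    ultimately show ?thesis using J unfolding J_def ctx_def by (intro runs_blk) simp_all
  qed
  have loop: "runs (Seq (WhilePos 8 item_body) (blk [LoadInd 0 12, SetOp 0 Mul 0 7])) m'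
      (n * (21 + ?pt) + 3) (\<lambda>m'. m' 0 = tgt * U)" if "J n m'" for m'
  proof (rule runs_call_seq)
    show "runs (WhilePos 8 item_body) m' (n * (21 + ?pt) + 1) (J 0)"
    proof (rule runs_while[where j = n and T = "20 + ?pt"])
      fix k m1 assume *: "J (Suc k) m1"
      then show "m1 8 > 0 \<and> runs item_body m1 (20 + ?pt) (J k)" using step[OF *] by (simp add: J_def)
    qed (use that in \<open>auto simp: J_def\<close>)
  next
    fix m1 assume "J 0 m1"
    then show "runs (blk [LoadInd 0 12, SetOp 0 Mul 0 7]) m1 (n * (21 + ?pt) + 3 - (n * (21 + ?pt) + 1))
      (\<lambda>m'. m' 0 = tgt * U)" using fin by simp
  qed simp
  have "runs main_com m (main_time n lbin b) (\<lambda>m'. m' 0 = tgt * U)"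
    unfolding main_com_def
  proof (rule runs_call_seq[OF runs_base[OF m(2,4,5) eps b]])
    fix m1 assume "eq_off {5, 6, 19, 24} m m1 \<and> m1 5 = real b \<and> m1 6 = real (b ^ (lbin + 1))"
    then have off1: "eq_off {5, 6, 19, 24} m m1" and m1: "m1 5 = real b" "m1 6 = real (b ^ (lbin + 1))"
      by auto
    have it1: "items n l w m1" by (rule items_eq_off[OF m(8) off1]) auto
    have r1: "m1 0 = real n" "m1 3 = eps" "m1 4 = 1" "m1 30 = real (64 * n)"
      using off1 m unfolding eq_off_def by auto
    show "runs (Seq ratio_com (Seq agent_com (Seq (blk [SetOp 8 Mul 0 4]) (Seq (WhilePos 8 item_body)
       (blk [LoadInd 0 12, SetOp 0 Mul 0 7]))))) m1 (main_time n lbin b - (3 * lbin + 10)) (\<lambda>m'. m' 0 = tgt * U)"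
    proof (rule runs_call_seq[OF runs_ratio[OF r1 it1 n]])
      fix m2 assume "eq_off {7, 8, 9, 10, 11, 25, 26, 28} m1 m2
        \<and> m2 7 = eps * Max ((\<lambda>k. real (w k) / real (l k)) ` {1..n})"
      then have off2: "eq_off {7, 8, 9, 10, 11, 25, 26, 28} m1 m2" and m2: "m2 7 = U" using U by auto
      have it2: "items n l w m2" by (rule items_eq_off[OF it1 off2]) auto
      have c2: "ctx n lbin b U m2" "m2 2 = real i"
        using off1 off2 m m1 m2 unfolding eq_off_def ctx_def by auto
      have li: "l i \<le> lbin" using l i by blast
      show "runs (Seq agent_com (Seq (blk [SetOp 8 Mul 0 4]) (Seq (WhilePos 8 item_body)
       (blk [LoadInd 0 12, SetOp 0 Mul 0 7])))) m2 (main_time n lbin b - (3 * lbin + 10) - (18 * n + 4))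
        (\<lambda>m'. m' 0 = tgt * U)"
      proof (rule runs_call_seq[OF runs_agent[OF c2(1) it2 c2(2) i b0 li U0]])
        fix m3 assume "ctx n lbin b U m3 \<and> items n (l(i := 0)) (w(i := 0)) m3
          \<and> (\<forall>x<(n + 1) * b ^ (lbin + 1). m3 (128 * n + x) = real (gain b (l i) (rnd U w i) x (lbin - l i)))"
        then have "J n (fold ev [SetOp 8 Mul 0 4] m3)"
          by (intro init) (auto simp: l0_def w0_def w'_def)
        then show "runs (Seq (blk [SetOp 8 Mul 0 4]) (Seq (WhilePos 8 item_body)
          (blk [LoadInd 0 12, SetOp 0 Mul 0 7]))) m3
          (main_time n lbin b - (3 * lbin + 10) - (18 * n + 4) - (22 + pass_time n lbin b)) (\<lambda>m'. m' 0 = tgt * U)"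
          by (intro runs_blk_seq runs_mono[OF loop]) (auto simp: main_time_def)
      qed (simp add: main_time_def)
    qed (simp add: main_time_def)
  qed (simp add: main_time_def)
  then show ?thesis unfolding tgt_def w'_def .
qed

section \<open>Error and running time\<close>

lemma opt_marginal:
  assumes "finite S" "i \<notin> S"
  shows "opt l w S c \<le> opt l w (insert i S) c" "opt l w (insert i S) c \<le> opt l w S c + w i"
proof -
  obtain R where R: "R \<subseteq> S" "sum l R \<le> c - l i" "opt l w S (c - l i) = sum w R"
    using opt_witness[OF assms(1)] .
  then have "opt l w S (c - l i) \<le> opt l w S c" using assms(1) by (auto intro: opt_ge)
  then show "opt l w S c \<le> opt l w (insert i S) c" "opt l w (insert i S) c \<le> opt l w S c + w i"
    unfolding opt_insert[OF assms] by auto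
qed

lemma main_time_le:
  assumes "n \<ge> 1" "lbin \<ge> 1" "b \<ge> 1"
  shows "main_time n lbin b \<le> 600 * (lbin * b ^ (lbin + 1) * n ^ 2)"
proof -
  let ?B = "b ^ (lbin + 1)"
  have B: "?B \<ge> 1" using assms by simp
  define X where "X = lbin * ?B * n"
  have x1: "lbin \<le> X" "n \<le> X" "1 \<le> X"
    unfolding X_def using assms B by auto
  have "(n + 1) * ?B * (18 * lbin + 45) \<le> (2 * n) * ?B * (63 * lbin)"
    using assms by (intro mult_mono) auto
  also have "\<dots> = 126 * X" unfolding X_def by simp
  finally have pt: "pass_time n lbin b \<le> 136 * X"
    unfolding pass_time_def using x1 by linarith
  have "main_time n lbin b \<le> 3 * X + 18 * X + 41 * X + 136 * X + n * (21 * X + 136 * X)"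
    unfolding main_time_def using pt x1 by (intro add_mono mult_left_mono) auto
  also have "\<dots> \<le> n * (198 * X) + n * (157 * X)" using assms(1) by simp
  also have "\<dots> \<le> 600 * (n * X)" by simp
  also have "n * X = lbin * ?B * n ^ 2" unfolding X_def by (simp add: power2_eq_square)
  finally show ?thesis .
qed

text \<open>The surplus factor \<open>lbin\<close> is absorbed by a single factor \<open>b\<close>:
  \<open>lbin * b\<close> is at most \<open>lbin ^ 2 / eps + lbin\<close>. Here
  \<open>eps < 1\<close> gives \<open>lbin \<le> lbin ^ 2 / eps\<close>.\<close>

lemma lbin_base_le:
  assumes "lbin \<ge> 1" "0 < eps" "eps < 1" and b: "b = nat \<lfloor>real lbin / eps\<rfloor> + 1"
  shows "real lbin * real b ^ (lbin + 1) \<le> 2 * (real lbin ^ 2 / eps + 1) ^ (lbin + 1)"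
proof -
  define q where "q = real lbin ^ 2 / eps"
  have le: "real lbin \<le> real lbin ^ 2" using assms(1) by (simp add: power2_eq_square)
  have "real lbin ^ 2 \<le> q" unfolding q_def using assms(2,3) by (simp add: field_simps mult_left_le_one_le)
  then have q: "real lbin \<le> q" using le by linarith
  have q0: "q \<ge> 0" unfolding q_def using assms(2) by simp
  have b1: "real b \<le> real lbin / eps + 1" unfolding b using assms(2) by simp
  moreover have "real lbin / eps \<le> q" unfolding q_def using le assms(2) by (simp add: divide_right_mono)
  ultimately have bz: "real b \<le> q + 1" by linarith
  have "real lbin * real b \<le> real lbin * (real lbin / eps + 1)"
    using b1 by (intro mult_left_mono) auto
  also have "\<dots> = q + real lbin" unfolding q_def by (simp add: power2_eq_square distrib_left)
  also have "\<dots> \<le> 2 * (q + 1)" using q by (simp add: distrib_left)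
  finally have "real lbin * real b \<le> 2 * (q + 1)" .
  moreover have "real b ^ lbin \<le> (q + 1) ^ lbin" using bz by (intro power_mono) auto
  ultimately have "(real lbin * real b) * real b ^ lbin \<le> (2 * (q + 1)) * (q + 1) ^ lbin"
    by (rule mult_mono) (use q0 in auto)
  then show ?thesis unfolding q_def by (simp only: mult.assoc Suc_eq_plus1[symmetric] power_Suc)
qed

theorem theorem3:
  "\<exists>(P::com) (C::real). C > 0 \<and>
     (\<forall>(n::nat) (l::nat \<Rightarrow> nat) (w::nat \<Rightarrow> nat) (lbin::nat) (i::nat) (eps::real).
        1 \<le> n \<longrightarrow> i \<in> {1..n} \<longrightarrow> (\<forall>k\<in>{1..n}. 0 < l k \<and> l k \<le> lbin) \<longrightarrow> eps > 0 \<longrightarrow>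
        (\<exists>t m'. exec P (init_mem n l w lbin i eps) t m' \<and>
           real t \<le> C * ((real lbin ^ 2 / eps + 1) ^ (lbin + 1) * real n ^ 2) \<and>
           \<bar>m' 0 - shapley {1..n} (knap_val l w lbin) i\<bar> \<le> eps * real_of_int (w_max n l w lbin)))"
\<comment> \<open>The constant 1400 covers 1200 for the selected branch and 194 for relocation and
  setup, as the remaining product is at least 1.\<close>
proof (intro exI[of _ shapley_com] exI[of _ "1400::real"] conjI allI impI)
  fix n :: nat and l w :: "nat \<Rightarrow> nat" and lbin i :: nat and eps :: real
  assume n: "1 \<le> n" and i: "i \<in> {1..n}" and "\<forall>k\<in>{1..n}. 0 < l k \<and> l k \<le> lbin" and eps: "eps > 0"
  then have l: "\<And>k. k \<in> {1..n} \<Longrightarrow> 0 < l k \<and> l k \<le> lbin" by blast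
  define Z where "Z = (real lbin ^ 2 / eps + 1) ^ (lbin + 1)"
  define r where "r = Max ((\<lambda>k. real (w k) / real (l k)) ` {1..n})"
  define b where "b = nat \<lfloor>real lbin / eps\<rfloor> + 1"
  define U where "U = eps * r"
  define g where "g S = (real (opt l (rnd U w) (insert i S) lbin) - real (opt l (rnd U w) S lbin)) * U" for S
  let ?v = "knap_val l w lbin"
  let ?Q = "\<lambda>m'. \<bar>m' 0 - shapley {1..n} ?v i\<bar> \<le> eps * real_of_int (w_max n l w lbin)"
  have li: "0 < l i" "l i \<le> lbin" using l i by auto
  have wm: "real lbin * r \<le> real_of_int (w_max n l w lbin)" unfolding w_max_def r_def by linarith
  have r_ge: "real (w i) / real (l i) \<le> r" unfolding r_def using i by (intro Max_ge) auto
  have "0 \<le> real (w i) / real (l i)" by simp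
  then have r0: "r \<ge> 0" using r_ge by linarith
  have rb: "U * real (rnd U w k) \<le> real (w k)" "real (w k) \<le> U * real (rnd U w k) + U" "U \<ge> 0"
    if "k \<in> {1..n}" for k
    using rnd_bounds(1,2,4)[OF that l[OF that, THEN conjunct1] eps U_def[unfolded r_def]] .
  have U0: "U \<ge> 0" using rb(3)[OF i] .
  have fin: "finite S" "finite (insert i S)" "i \<notin> S" "S \<subseteq> {1..n}" "insert i S \<subseteq> {1..n}"
    if "S \<subseteq> {1..n} - {i}" for S
    using that i finite_subset[of S "{1..n}"] by auto
  \<comment> \<open>Both coalition values are underestimated, by between 0 and
    \<open>lbin * U\<close>. Errors of equal sign keep the difference within
    \<open>lbin * U\<close>, without a factor 2.\<close>
  have err: "\<bar>g S - (?v (insert i S) - ?v S)\<bar> \<le> real lbin * U" if S: "S \<subseteq> {1..n} - {i}" for S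
  proof -
    have *: "U * real (opt l (rnd U w) A lbin) \<le> real (opt l w A lbin)"
      "real (opt l w A lbin) \<le> U * real (opt l (rnd U w) A lbin) + real lbin * U"
      if A: "A \<subseteq> {1..n}" for A
    proof -
      have f: "finite A" using A finite_subset by blast
      have k: "k \<in> {1..n}" if "k \<in> A" for k using A that by blast
      have "0 < l k" if "k \<in> A" for k using l[OF k[OF that]] by blast
      note rounding = opt_rounding[of A l U "rnd U w" w lbin, OF f this rb(1)[OF k] rb(2)[OF k] U0]
      show "U * real (opt l (rnd U w) A lbin) \<le> real (opt l w A lbin)" by (rule rounding(1))
      show "real (opt l w A lbin) \<le> U * real (opt l (rnd U w) A lbin) + real lbin * U"
        by (rule rounding(2))
    qed
    show ?thesis
      using *[OF fin(4)[OF S]] *[OF fin(5)[OF S]] unfolding g_def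
      by (simp add: knap_val_eq fin[OF S] algebra_simps)
  qed
  have "real lbin * U \<le> eps * real_of_int (w_max n l w lbin)"
    using mult_left_mono[OF wm, of eps] eps unfolding U_def by (simp add: mult.left_commute)
  then have approx: "\<bar>(\<Sum>S\<in>Pow {1..n}. wgt n (card S) * g (S - {i})) - shapley {1..n} ?v i\<bar>
      \<le> eps * real_of_int (w_max n l w lbin)"
    using abs_shapley_diff_le[where g = g and v = ?v, OF i err] by linarith
  \<comment> \<open>A marginal contribution lies between 0 and \<open>w i\<close>, and
    \<open>w i\<close> is at most \<open>r * lbin\<close>, hence at most
    \<open>w_max\<close>.\<close>
  have zero: "\<bar>0 - shapley {1..n} ?v i\<bar> \<le> eps * real_of_int (w_max n l w lbin)" if "eps \<ge> 1"
  proof -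
    have "real (w i) \<le> r * real (l i)" using r_ge li by (simp add: field_simps)
    also have "\<dots> \<le> r * real lbin" using r0 li by (intro mult_left_mono) auto
    finally have w: "real (w i) \<le> real_of_int (w_max n l w lbin)" using wm by (simp add: mult.commute)
    have "\<bar>0 - (?v (insert i S) - ?v S)\<bar> \<le> real (w i)" if S: "S \<subseteq> {1..n} - {i}" for S
      using opt_marginal[OF fin(1,3)[OF S], where l = l and w = w and c = lbin] by (simp add: knap_val_eq fin[OF S])
    then have "\<bar>(\<Sum>S\<in>Pow {1..n}. wgt n (card S) * 0) - shapley {1..n} ?v i\<bar> \<le> real (w i)"
      by (rule abs_shapley_diff_le[where g = "\<lambda>_. 0" and v = ?v, OF i])
    also have "\<dots> \<le> eps * real_of_int (w_max n l w lbin)"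
      using mult_mono[OF that w] eps by simp
    finally show ?thesis by simp
  qed
  define T where "T = (if eps < 1 then main_time n lbin b else 1)"
  \<comment> \<open>186 steps relocate the input; the 8 are seven setup instructions and one
    test.\<close>
  have "runs shapley_com (init_mem n l w lbin i eps) (186 + (8 + T)) ?Q"
    unfolding shapley_com_def
  proof (rule runs_call_seq[OF runs_relocate[OF refl n]])
    fix m1 assume *: "m1 0 = real (64 * n + 60) \<and> m1 1 = real lbin \<and> m1 2 = real i
      \<and> m1 3 = eps \<and> m1 4 = 1 \<and> items n l w m1"
    let ?cs = "[SetConst 28 60, SetOp 0 Sub 0 28, SetOp 12 Add 0 0, SetOp 30 Mul 0 4, SetConst 28 64,
         SetOp 0 Dvd 0 28, SetOp 29 Sub 4 3]"
    define m2 where "m2 = fold ev ?cs m1"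
    have m2: "m2 0 = real n" "m2 1 = real lbin" "m2 2 = real i" "m2 3 = eps" "m2 4 = 1"
      "m2 12 = real (128 * n)" "m2 30 = real (64 * n)" "m2 29 = 1 - eps"
      unfolding m2_def using * by simp_all
    have off: "eq_off {0, 12, 28, 29, 30} m1 m2" unfolding m2_def by (simp add: eq_off_def)
    have it: "items n l w m2" by (rule items_eq_off[OF _ off]) (use * in auto)
    show "runs (Seq (blk ?cs) (IfPos 29 main_com (blk [SetConst 0 0]))) m1 (186 + (8 + T) - 186) ?Q"
    proof (rule runs_blk_seq, simp, unfold m2_def[symmetric], rule runs_if)
      assume "m2 29 > 0"
      then have "eps < 1" using m2 by simp
      then have "T = main_time n lbin b" unfolding T_def by simp
      then show "runs main_com m2 (186 + (8 + T) - 186 - length ?cs - 1) ?Q"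
        using approx unfolding g_def
        by (intro runs_mono[OF runs_main[OF m2(1-7) it i l eps b_def U_def[unfolded r_def]]])
          (auto simp: sum_distrib_right mult.assoc)
    next
      assume "\<not> m2 29 > 0"
      then show "runs (blk [SetConst 0 0]) m2 (186 + (8 + T) - 186 - length ?cs - 1) ?Q"
        using m2 zero by (intro runs_blk) (auto simp: T_def)
    qed auto
  qed auto
  then obtain t m' where t: "exec shapley_com (init_mem n l w lbin i eps) t m'" "t \<le> 194 + T" "?Q m'"
    unfolding runs_def by auto
  have Z1: "Z \<ge> 1" unfolding Z_def using eps by (intro one_le_power) simp
  have "real T \<le> 1200 * (Z * real n ^ 2)"
  proof (cases "eps < 1")
    case True
    have "lbin \<ge> 1" using li by simp
    have "real T \<le> 600 * (real lbin * real b ^ (lbin + 1) * real n ^ 2)"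
    proof -
      have "real (main_time n lbin b) \<le> real (600 * (lbin * b ^ (lbin + 1) * n ^ 2))"
        using main_time_le[OF n \<open>lbin \<ge> 1\<close>, of b] by (simp only: of_nat_le_iff b_def)
      then show ?thesis unfolding T_def using True by simp
    qed
    also have "\<dots> \<le> 600 * (2 * Z * real n ^ 2)"
      using lbin_base_le[OF \<open>lbin \<ge> 1\<close> eps True b_def] unfolding Z_def
      by (intro mult_left_mono mult_right_mono) auto
    finally show ?thesis by simp
  next
    case False
    have "1 * 1 \<le> Z * real n ^ 2" using Z1 n by (intro mult_mono one_le_power) auto
    then show ?thesis unfolding T_def using False by simp
  qed
  moreover have "1 * 1 \<le> Z * real n ^ 2" using Z1 n by (intro mult_mono one_le_power) auto
  ultimately have "real t \<le> 1400 * (Z * real n ^ 2)" using t(2) by linarith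
  then show "\<exists>t m'. exec shapley_com (init_mem n l w lbin i eps) t m' \<and>
           real t \<le> 1400 * ((real lbin ^ 2 / eps + 1) ^ (lbin + 1) * real n ^ 2) \<and> ?Q m'"
    using t unfolding Z_def by blast
qed simp

end
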